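(* Assume the standing hypotheses H1, H2, H3 listed in the context. The solution $U^n\in V_h$ of the fully-discrete $L2$-$1_\sigma$ finite element scheme on the graded mesh described in the context satisfies $$\|U^n\|\le C\,(1+\|U^0\|),$$ $$\|\nabla U^n\|\le C\,(1+\|\nabla U^0\|),$$ for each $n=1,\dots,N$. Here $C>0$ denotes a generic constant which is independent of the mesh parameters $h$ and $N$.
   Context: **Setting.** The scheme approximates the problem ${}^{c}_{0}D^{\alpha}_{t}u-a(l(u))\Delta u=f$ in $\Omega\times(0,T]$, $u=0$ on $\partial\Omega\times(0,T]$, $u(\cdot,0)=u_0$ in $\Omega$, where $\Omega\subseteq\mathbb{R}^d$ ($d=1$ or $2$) is a bounded domain with smooth boundary $\partial\Omega$, $T>0$, $\alpha\in(0,1)$, $l(w)=\int_\Omega w\,dx$, and ${}^{c}_{0}D^{\alpha}_{t}u(x,t)=\frac{1}{\Gamma(1-\alpha)}\int_0^t(t-s)^{-\alpha}\,\partial_su(x,s)\,ds$ is the Caputo derivative. $(\cdot,\cdot)$ and $\|\cdot\|$ are the inner product and norm of $L^2(\Omega)$. **Standing hypotheses.** H1: there are $m_1,m_2>0$ with $0<m_1\le a(x)\le m_2<\infty$ for all $x\in\mathbb{R}$. H2: $a:\mathbb{R}\to\mathbb{R}$ is Lipschitz continuous with constant $L$. H3: $f\in L^2(0,T;L^2(\Omega))$ and $u_0\in H^1_0(\Omega)\cap H^2(\Omega)$. **Space discretization.** $\Omega$ is partitioned quasi-uniformly into intervals ($d=1$) or triangles ($d=2$) with mesh size $h$; $V_h\subset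 H^1_0(\Omega)$ is the finite-dimensional space of continuous piecewise linear functions on this partition. **Time discretization.** $N\in\mathbb{N}$, $r\ge1$, $t_n=T(n/N)^r$ for $0\le n\le N$, $\tau_n=t_n-t_{n-1}$, $\sigma=\alpha/2$, $t_{n-\sigma}=(1-\sigma)t_n+\sigma t_{n-1}$, $t_{j-1/2}=(t_{j-1}+t_j)/2$. For a sequence $(v^n)$ put $v^{n,\sigma}=(1-\sigma)v^n+\sigma v^{n-1}$. The $L2$-$1_\sigma$ operator is $$D^\alpha_Nv^{n-\sigma}=\sum_{j=1}^n g_{n,j}(v^j-v^{j-1}),$$ where $g_{1,1}=\tau_1^{-1}a_{1,1}$ and for $n\ge2$: $g_{n,1}=\tau_1^{-1}(a_{n,1}-b_{n,1})$; $g_{n,j}=\tau_j^{-1}(a_{n,j}+b_{n,j-1}-b_{n,j})$ for $2\le j\le n-1$; $g_{n,n}=\tau_n^{-1}(a_{n,n}+b_{n,n-1})$; with $$a_{n,n}=\tfrac{1}{\Gamma(1-\alpha)}\int_{t_{n-1}}^{t_{n-\sigma}}(t_{n-\sigma}-\eta)^{-\alpha}d\eta,\qquad a_{n,j}=\tfrac{1}{\Gamma(1-\alpha)}\int_{t_{j-1}}^{t_j}(t_{n-\sigma}-\eta)^{-\alpha}d\eta\ (1\le j\le n-1),$$ $$b_{n,j}=\tfrac{2}{\Gamma(1-\alpha)(t_{j+1}-t_{j-1})}\int_{t_{j-1}}^{t_j}(t_{n-\sigma}-\eta)^{-\alpha}(\eta-t_{j-1/2})\,d\eta\ (1\le j\le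 n-1).$$ **Fully-discrete scheme.** $U^0=u_h^0$, where $u_h^0$ is some approximation of $u_0$, and for each $n=1,\dots,N$ one finds $U^n\in V_h$ such that for all $v_h\in V_h$ $$(D^\alpha_NU^{n-\sigma},v_h)+a\big(l(U^{n,\sigma})\big)(\nabla U^{n,\sigma},\nabla v_h)=(f^{n-\sigma},v_h),\qquad f^{n-\sigma}:=f(\cdot,t_{n-\sigma}).$$
   Formalization: Since f in L²(0,T;L²) neither defines nor bounds f(·,t_{n-σ}), C is uniform over meshes with ‖f^{n-σ}‖ ≤ F for all n, F fixed in advance, and depends on F; for d=2 the triangles lie in the closed domain and may omit a boundary layer of width at most h. *)

theory Defs
  imports "HOL-Analysis.Analysis"
begin

section \<open>Smooth functions and domains\<close>

text \<open>Intended for open sets, where \<open>f\<close> is \<open>C\<^sup>k\<^sup>+\<^sup>1\<close> iff it is differentiable and all its first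
  partial derivatives are \<open>C\<^sup>k\<close>.\<close>

fun Ck_on :: "nat \<Rightarrow> 'a::euclidean_space set \<Rightarrow> ('a \<Rightarrow> real) \<Rightarrow> bool" where
  "Ck_on 0 S f \<longleftrightarrow> continuous_on S f"
| "Ck_on (Suc k) S f \<longleftrightarrow>
     f differentiable_on S \<and> (\<forall>i\<in>Basis. Ck_on k S (\<lambda>x. frechet_derivative f (at x) i))"

definition smooth_on :: "'a::euclidean_space set \<Rightarrow> ('a \<Rightarrow> real) \<Rightarrow> bool" where
  "smooth_on S f \<longleftrightarrow> (\<forall>k. Ck_on k S f)"

definition bounded_domain :: "'a::euclidean_space set \<Rightarrow> bool" where
  "bounded_domain \<Omega> \<longleftrightarrow> open \<Omega> \<and> connected \<Omega> \<and> bounded \<Omega> \<and> \<Omega> \<noteq> {}"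

text \<open>Near each boundary point, \<open>\<Omega>\<close> is a strict sublevel set of a smooth function without critical
  points.\<close>

definition smooth_boundary :: "'a::euclidean_space set \<Rightarrow> bool" where
  "smooth_boundary \<Omega> \<longleftrightarrow>
     (\<forall>p\<in>frontier \<Omega>. \<exists>W \<phi>. open W \<and> p \<in> W \<and> smooth_on W \<phi> \<and>
        (\<forall>x\<in>W. frechet_derivative \<phi> (at x) \<noteq> (\<lambda>_. 0)) \<and>
        \<Omega> \<inter> W = {x\<in>W. \<phi> x < 0})"


section \<open>Lebesgue and Sobolev spaces\<close>

text \<open>Elements of \<open>L\<^sup>2(\<Omega>)\<close> and of the Sobolev spaces are represented by functions on the whole
  space; only their values almost everywhere on \<open>\<Omega>\<close> matter.\<close>

definition L2_space :: "'a::euclidean_space set \<Rightarrow> ('a \<Rightarrow> real) set" where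
  "L2_space \<Omega> = {u. u \<in> borel_measurable (lebesgue_on \<Omega>) \<and>
                     integrable (lebesgue_on \<Omega>) (\<lambda>x. (u x)\<^sup>2)}"

definition L2_inner :: "'a::euclidean_space set \<Rightarrow> ('a \<Rightarrow> real) \<Rightarrow> ('a \<Rightarrow> real) \<Rightarrow> real" where
  "L2_inner \<Omega> u v = (LINT x|lebesgue_on \<Omega>. u x * v x)"

definition L2_norm :: "'a::euclidean_space set \<Rightarrow> ('a \<Rightarrow> real) \<Rightarrow> real" where
  "L2_norm \<Omega> u = sqrt (L2_inner \<Omega> u u)"

definition test_functions :: "'a::euclidean_space set \<Rightarrow> ('a \<Rightarrow> real) set" where
  "test_functions \<Omega> =
     {\<phi>. smooth_on UNIV \<phi> \<and> (\<exists>K. compact K \<and> K \<subseteq> \<Omega> \<and> (\<forall>x. x \<notin> K \<longrightarrow> \<phi> x = 0))}"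

definition has_weak_partial ::
    "'a::euclidean_space set \<Rightarrow> ('a \<Rightarrow> real) \<Rightarrow> 'a \<Rightarrow> ('a \<Rightarrow> real) \<Rightarrow> bool" where
  "has_weak_partial \<Omega> u i g \<longleftrightarrow>
     (\<forall>\<phi>\<in>test_functions \<Omega>.
        L2_inner \<Omega> u (\<lambda>x. frechet_derivative \<phi> (at x) i) = - L2_inner \<Omega> g \<phi>)"

definition sobolev_H1 :: "'a::euclidean_space set \<Rightarrow> ('a \<Rightarrow> real) set" where
  "sobolev_H1 \<Omega> =
     {u \<in> L2_space \<Omega>. \<forall>i\<in>Basis. \<exists>g\<in>L2_space \<Omega>. has_weak_partial \<Omega> u i g}"

definition sobolev_H2 :: "'a::euclidean_space set \<Rightarrow> ('a \<Rightarrow> real) set" where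
  "sobolev_H2 \<Omega> =
     {u \<in> L2_space \<Omega>. \<forall>i\<in>Basis. \<exists>g\<in>sobolev_H1 \<Omega>. has_weak_partial \<Omega> u i g}"

text \<open>A weak partial derivative is unique up to null sets, so for \<open>u \<in> H\<^sup>1(\<Omega>)\<close> the integrals below
  do not depend on the choice.\<close>

definition weak_partial :: "'a::euclidean_space set \<Rightarrow> ('a \<Rightarrow> real) \<Rightarrow> 'a \<Rightarrow> 'a \<Rightarrow> real" where
  "weak_partial \<Omega> u i = (SOME g. g \<in> L2_space \<Omega> \<and> has_weak_partial \<Omega> u i g)"

definition grad_inner :: "'a::euclidean_space set \<Rightarrow> ('a \<Rightarrow> real) \<Rightarrow> ('a \<Rightarrow> real) \<Rightarrow> real" where
  "grad_inner \<Omega> u v = (\<Sum>i\<in>Basis. L2_inner \<Omega> (weak_partial \<Omega> u i) (weak_partial \<Omega> v i))"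

definition grad_norm :: "'a::euclidean_space set \<Rightarrow> ('a \<Rightarrow> real) \<Rightarrow> real" where
  "grad_norm \<Omega> u = sqrt (grad_inner \<Omega> u u)"

definition H1_norm :: "'a::euclidean_space set \<Rightarrow> ('a \<Rightarrow> real) \<Rightarrow> real" where
  "H1_norm \<Omega> u = sqrt ((L2_norm \<Omega> u)\<^sup>2 + (grad_norm \<Omega> u)\<^sup>2)"

definition sobolev_H10 :: "'a::euclidean_space set \<Rightarrow> ('a \<Rightarrow> real) set" where
  "sobolev_H10 \<Omega> =
     {u \<in> sobolev_H1 \<Omega>. \<exists>\<phi>. (\<forall>k::nat. \<phi> k \<in> test_functions \<Omega>) \<and>
        (\<lambda>k. H1_norm \<Omega> (\<lambda>x. \<phi> k x - u x)) \<longlonglongrightarrow> 0}"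

text \<open>The Bochner space \<open>L\<^sup>2(0,T;L\<^sup>2(\<Omega>))\<close>. Its elements are represented by maps \<open>t \<mapsto> f t\<close> that take
  values in \<open>L\<^sup>2(\<Omega>)\<close> at every time of \<open>(0,T)\<close>, so that point values in time make sense; strong
  measurability is almost everywhere approximation by simple functions.\<close>

definition simple_L2_map :: "'a::euclidean_space set \<Rightarrow> (real \<Rightarrow> 'a \<Rightarrow> real) \<Rightarrow> bool" where
  "simple_L2_map \<Omega> s \<longleftrightarrow>
     finite (range s) \<and> range s \<subseteq> L2_space \<Omega> \<and> (\<forall>w. s -` {w} \<in> sets lebesgue)"

definition Bochner_L2 :: "real \<Rightarrow> 'a::euclidean_space set \<Rightarrow> (real \<Rightarrow> 'a \<Rightarrow> real) set" where
  "Bochner_L2 T \<Omega> =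
     {f. (\<forall>t\<in>{0<..<T}. f t \<in> L2_space \<Omega>) \<and>
         (\<exists>s. (\<forall>k::nat. simple_L2_map \<Omega> (s k)) \<and>
            (AE t in lebesgue_on {0<..<T}. (\<lambda>k. L2_norm \<Omega> (\<lambda>x. s k t x - f t x)) \<longlonglongrightarrow> 0)) \<and>
         integrable (lebesgue_on {0<..<T}) (\<lambda>t. (L2_norm \<Omega> (f t))\<^sup>2)}"


section \<open>Finite element space\<close>

definition mesh_size :: "'a::euclidean_space set set \<Rightarrow> real" where
  "mesh_size Th = Max (diameter ` Th)"

text \<open>In one dimension the intervals partition the closure of \<open>\<Omega>\<close> exactly. Finitely many triangles
  cannot fill a planar domain with smooth boundary, so in higher dimension the triangles lie
  in the closure of \<open>\<Omega>\<close> and may leave out a boundary layer whose width is at most the mesh size;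
  exact partitions are a special case. Quasi-uniformity with constant \<open>\<kappa>\<close>: every element contains a
  ball of radius \<open>\<kappa> h\<close>.\<close>

definition quasi_uniform_mesh ::
    "real \<Rightarrow> 'a::euclidean_space set \<Rightarrow> 'a set set \<Rightarrow> bool" where
  "quasi_uniform_mesh \<kappa> \<Omega> Th \<longleftrightarrow>
     Th \<noteq> {} \<and> triangulation Th \<and>
     (\<forall>K\<in>Th. int DIM('a) simplex K) \<and>
     (if DIM('a) = 1 then \<Union>Th = closure \<Omega>
      else \<Union>Th \<subseteq> closure \<Omega> \<and> (\<forall>x\<in>\<Omega> - \<Union>Th. infdist x (frontier \<Omega>) \<le> mesh_size Th)) \<and>
     (\<forall>K\<in>Th. \<exists>c. cball c (\<kappa> * mesh_size Th) \<subseteq> K)"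

text \<open>Finite element functions are extended by zero outside the triangulated set. This makes the
  representing function unique and, by continuity, encodes the boundary condition.\<close>

definition fem_space :: "'a::euclidean_space set \<Rightarrow> 'a set set \<Rightarrow> ('a \<Rightarrow> real) set" where
  "fem_space \<Omega> Th =
     {v \<in> sobolev_H10 \<Omega>. continuous_on UNIV v \<and>
        (\<forall>K\<in>Th. \<exists>b c. \<forall>x\<in>K. v x = b \<bullet> x + c) \<and>
        (\<forall>x. x \<notin> \<Union>Th \<longrightarrow> v x = 0)}"


section \<open>The \<open>L2-1\<^sub>\<sigma>\<close> operator on the graded mesh\<close>

definition node :: "real \<Rightarrow> real \<Rightarrow> nat \<Rightarrow> nat \<Rightarrow> real" where
  "node T r N n = T * (real n / real N) powr r"

definition step :: "real \<Rightarrow> real \<Rightarrow> nat \<Rightarrow> nat \<Rightarrow> real" where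
  "step T r N n = node T r N n - node T r N (n - 1)"

definition node_sigma :: "real \<Rightarrow> real \<Rightarrow> real \<Rightarrow> nat \<Rightarrow> nat \<Rightarrow> real" where
  "node_sigma \<alpha> T r N n =
     (let \<sigma> = \<alpha> / 2 in (1 - \<sigma>) * node T r N n + \<sigma> * node T r N (n - 1))"

definition node_half :: "real \<Rightarrow> real \<Rightarrow> nat \<Rightarrow> nat \<Rightarrow> real" where
  "node_half T r N j = (node T r N (j - 1) + node T r N j) / 2"

definition coeff_a :: "real \<Rightarrow> real \<Rightarrow> real \<Rightarrow> nat \<Rightarrow> nat \<Rightarrow> nat \<Rightarrow> real" where
  "coeff_a \<alpha> T r N n j =
     1 / Gamma (1 - \<alpha>) *
     integral {node T r N (j - 1) .. (if j = n then node_sigma \<alpha> T r N n else node T r N j)}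
       (\<lambda>\<eta>. (node_sigma \<alpha> T r N n - \<eta>) powr (-\<alpha>))"

definition coeff_b :: "real \<Rightarrow> real \<Rightarrow> real \<Rightarrow> nat \<Rightarrow> nat \<Rightarrow> nat \<Rightarrow> real" where
  "coeff_b \<alpha> T r N n j =
     2 / (Gamma (1 - \<alpha>) * (node T r N (j + 1) - node T r N (j - 1))) *
     integral {node T r N (j - 1) .. node T r N j}
       (\<lambda>\<eta>. (node_sigma \<alpha> T r N n - \<eta>) powr (-\<alpha>) * (\<eta> - node_half T r N j))"

definition coeff_g :: "real \<Rightarrow> real \<Rightarrow> real \<Rightarrow> nat \<Rightarrow> nat \<Rightarrow> nat \<Rightarrow> real" where
  "coeff_g \<alpha> T r N n j =
     inverse (step T r N j) *
     (if n = 1 then coeff_a \<alpha> T r N n j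
      else if j = 1 then coeff_a \<alpha> T r N n j - coeff_b \<alpha> T r N n j
      else if j < n then coeff_a \<alpha> T r N n j + coeff_b \<alpha> T r N n (j - 1) - coeff_b \<alpha> T r N n j
      else coeff_a \<alpha> T r N n j + coeff_b \<alpha> T r N n (j - 1))"

definition L2_1sigma ::
    "real \<Rightarrow> real \<Rightarrow> real \<Rightarrow> nat \<Rightarrow> (nat \<Rightarrow> 'a \<Rightarrow> real) \<Rightarrow> nat \<Rightarrow> 'a \<Rightarrow> real" where
  "L2_1sigma \<alpha> T r N v n = (\<lambda>x. \<Sum>j=1..n. coeff_g \<alpha> T r N n j * (v j x - v (j - 1) x))"

definition sigma_avg :: "real \<Rightarrow> (nat \<Rightarrow> 'a \<Rightarrow> real) \<Rightarrow> nat \<Rightarrow> 'a \<Rightarrow> real" where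
  "sigma_avg \<alpha> v n = (let \<sigma> = \<alpha> / 2 in (\<lambda>x. (1 - \<sigma>) * v n x + \<sigma> * v (n - 1) x))"


section \<open>The fully-discrete scheme\<close>

definition total :: "'a::euclidean_space set \<Rightarrow> ('a \<Rightarrow> real) \<Rightarrow> real" where
  "total \<Omega> w = (LINT x|lebesgue_on \<Omega>. w x)"

definition fully_discrete_solution ::
    "'a::euclidean_space set \<Rightarrow> (real \<Rightarrow> real) \<Rightarrow> (real \<Rightarrow> 'a \<Rightarrow> real) \<Rightarrow> real \<Rightarrow> real \<Rightarrow> real \<Rightarrow>
     'a set set \<Rightarrow> nat \<Rightarrow> (nat \<Rightarrow> 'a \<Rightarrow> real) \<Rightarrow> bool" where
  "fully_discrete_solution \<Omega> a f \<alpha> T r Th N U \<longleftrightarrow>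
     U 0 \<in> fem_space \<Omega> Th \<and>
     (\<forall>n\<in>{1..N}. U n \<in> fem_space \<Omega> Th \<and>
        (\<forall>v\<in>fem_space \<Omega> Th.
           L2_inner \<Omega> (L2_1sigma \<alpha> T r N U n) v
           + a (total \<Omega> (sigma_avg \<alpha> U n)) * grad_inner \<Omega> (sigma_avg \<alpha> U n) v
           = L2_inner \<Omega> (f (node_sigma \<alpha> T r N n)) v))"

end

theory Submission
  imports Defs
begin

text \<open>Write \<open>k(\<eta>) = (t\<^sub>n\<^sub>-\<^sub>\<sigma> - \<eta>)\<^sup>-\<^sup>\<alpha> / \<Gamma>(1 - \<alpha>)\<close>. Since \<open>k\<close> is increasing and convex and the steps of the
  graded mesh do not decrease, the weights are separated by the kernel:
  \<open>k(t\<^sub>j\<^sub>-\<^sub>1) \<le> g\<^sub>n\<^sub>,\<^sub>j \<le> k(t\<^sub>j)\<close> for \<open>j < n\<close>, and \<open>(1 - \<sigma>) k(t\<^sub>n\<^sub>-\<^sub>1) \<le> (1 - 2\<sigma>) g\<^sub>n\<^sub>,\<^sub>n\<close>. Hence the weights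
  increase in \<open>j\<close>, \<open>g\<^sub>n\<^sub>,\<^sub>1 \<ge> c\<close> with \<open>c = T\<^sup>-\<^sup>\<alpha> / \<Gamma>(1 - \<alpha>)\<close>, and Alikhanov's inequality
  \<open>(D v, v\<^sup>\<sigma>) \<ge> D \<parallel>v\<parallel>\<^sup>2 / 2\<close> holds. A sequence with \<open>D w \<le> K\<close> therefore satisfies
  \<open>w\<^sub>n \<le> w\<^sub>0 + K / c\<close>.

  Testing the scheme with \<open>U\<^sup>n\<^sup>,\<^sup>\<sigma>\<close> gives \<open>D \<parallel>U\<parallel>\<^sup>2 \<le> 2 F max\<^sub>k \<parallel>U\<^sup>k\<parallel>\<close>, testing it with \<open>D U\<close> gives
  \<open>D \<parallel>\<nabla>U\<parallel>\<^sup>2 \<le> F\<^sup>2 / (2 m\<^sub>1)\<close>. Because \<open>weak_partial\<close> is a choice, bilinearity of the gradient form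
  rests on the uniqueness of weak derivatives almost everywhere, and linearity of the finite element
  space on integration by parts for test functions.\<close>

section \<open>Kernel integrals\<close>

text \<open>The case \<open>q = s\<close>, with the kernel singular at the right end, is the one
  needed for the last cell. As \<open>1 - \<alpha>\<close> is positive, the antiderivative is still
  continuous there, and differentiability in the interior suffices for the fundamental
  theorem.\<close>

lemma powr_kernel_has_integral:
  fixes \<alpha> s p q :: real
  assumes "0 < \<alpha>" "\<alpha> < 1" "p \<le> q" "q \<le> s"
  shows "((\<lambda>\<eta>. (s - \<eta>) powr (-\<alpha>)) has_integral
           ((s - p) powr (1 - \<alpha>) - (s - q) powr (1 - \<alpha>)) / (1 - \<alpha>)) {p..q}"
proof -
  define G where "G \<eta> = - ((s - \<eta>) powr (1 - \<alpha>)) / (1 - \<alpha>)" for \<eta>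
  have "((\<lambda>\<eta>. (s - \<eta>) powr (-\<alpha>)) has_integral (G q - G p)) {p..q}"
  proof (rule fundamental_theorem_of_calculus_interior)
    show "continuous_on {p..q} G"
      unfolding G_def using assms by (intro continuous_intros continuous_on_powr') auto
    fix \<eta> assume "\<eta> \<in> {p<..<q}"
    then have "((\<lambda>\<eta>. (s - \<eta>) powr (1 - \<alpha>)) has_real_derivative
        - (1 - \<alpha>) * (s - \<eta>) powr (-\<alpha>)) (at \<eta>)"
      using assms DERIV_fun_powr[of "\<lambda>\<eta>. s - \<eta>" "-1" \<eta> "1 - \<alpha>"]
      by (auto intro!: derivative_eq_intros simp: algebra_simps)
    from DERIV_cdivide[OF DERIV_minus[OF this], of "1 - \<alpha>"]
    have "(G has_real_derivative - (- (1 - \<alpha>) * (s - \<eta>) powr (-\<alpha>)) / (1 - \<alpha>)) (at \<eta>)"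
      unfolding G_def .
    moreover have "- (- (1 - \<alpha>) * (s - \<eta>) powr (-\<alpha>)) / (1 - \<alpha>) = (s - \<eta>) powr (-\<alpha>)"
      using assms by (simp only: mult_minus_left minus_minus) simp
    ultimately show "(G has_vector_derivative (s - \<eta>) powr (-\<alpha>)) (at \<eta>)"
      unfolding has_real_derivative_iff_has_vector_derivative[symmetric] by metis
  qed (use assms in auto)
  then show ?thesis by (simp add: G_def diff_divide_distrib)
qed

text \<open>To the left of \<open>s\<close> the second derivative is positive, so the kernel is
  convex and lies above each of its tangents; the tangent is taken at \<open>x\<close>.\<close>

lemma powr_kernel_tangent:
  fixes \<alpha> s x y :: real
  assumes "0 < \<alpha>" "x < s" "y < s"
  shows "(s - x) powr (-\<alpha>) + \<alpha> * (s - x) powr (-\<alpha> - 1) * (y - x) \<le> (s - y) powr (-\<alpha>)"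
proof -
  have D: "((\<lambda>t. (s - t) powr (-\<alpha>)) has_real_derivative \<alpha> * (s - t) powr (-\<alpha> - 1)) (at t)"
    if "t < s" for t
    using that by (auto intro!: derivative_eq_intros simp: field_simps)
  moreover have "((\<lambda>t. \<alpha> * (s - t) powr (-\<alpha> - 1)) has_real_derivative
      \<alpha> * (\<alpha> + 1) * (s - t) powr (-\<alpha> - 2)) (at t)" if "t < s" for t
    using that by (auto intro!: derivative_eq_intros simp: field_simps)
  ultimately have C: "convex_on {..<s} (\<lambda>t. (s - t) powr (-\<alpha>))"
    using assms by (intro f''_ge0_imp_convex[where f' = "\<lambda>t. \<alpha> * (s - t) powr (-\<alpha> - 1)"
        and f'' = "\<lambda>t. \<alpha> * (\<alpha> + 1) * (s - t) powr (-\<alpha> - 2)"]) auto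
  have "\<alpha> * (s - x) powr (-\<alpha> - 1) * (y - x) \<le> (s - y) powr (-\<alpha>) - (s - x) powr (-\<alpha>)"
    using assms D
    by (intro convex_on_imp_above_tangent[OF C]) (auto simp: interior_open intro: has_field_derivative_at_within)
  then show ?thesis by simp
qed

section \<open>Mass and first moment of the kernel on an interval left of its singularity\<close>

context
  fixes \<alpha> s p q :: real
  assumes \<alpha>: "0 < \<alpha>" "\<alpha> < 1" and pq: "p < q" "q < s"
begin

private abbreviation (input) "k \<equiv> \<lambda>\<eta>. (s - \<eta>) powr (-\<alpha>)"
private abbreviation (input) "A \<equiv> integral {p..q} k"
private abbreviation (input) "M \<equiv> integral {p..q} (\<lambda>\<eta>. k \<eta> * (\<eta> - (p + q) / 2))"

private lemma cont: "continuous_on {p..q} k"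
  using pq by (intro continuous_intros) auto

private lemma k_mono: "x \<le> y \<Longrightarrow> y < s \<Longrightarrow> k x \<le> k y"
  using \<alpha> by (intro powr_mono2') auto

private lemma mid_has_integral: "((\<lambda>\<eta>. c * (\<eta> - (p + q) / 2)) has_integral 0) {p..q}"
proof -
  have "((\<lambda>\<eta>. c * (\<eta> - (p + q) / 2)) has_integral
      (c * (q - (p + q) / 2)\<^sup>2 / 2 - c * (p - (p + q) / 2)\<^sup>2 / 2)) {p..q}"
    using pq by (intro fundamental_theorem_of_calculus)
      (auto intro!: derivative_eq_intros simp: has_real_derivative_iff_has_vector_derivative[symmetric])
  moreover have "c * (q - (p + q) / 2)\<^sup>2 / 2 - c * (p - (p + q) / 2)\<^sup>2 / 2 = 0"
    by (simp add: power2_eq_square field_simps)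
  ultimately show ?thesis by simp
qed

private lemma kernel_ints: "(k has_integral A) {p..q}"
  "((\<lambda>\<eta>. k \<eta> * (\<eta> - (p + q) / 2)) has_integral M) {p..q}"
  using cont by (auto intro!: integrable_integral integrable_continuous_real continuous_intros)

text \<open>The distance to the midpoint has mean zero, so a constant may be subtracted from the
  kernel for free. Each bound on \<open>M\<close> below picks its own constant: the kernel value at
  the midpoint, the left end or the right end.\<close>

private lemma moment_shift:
  "((\<lambda>\<eta>. (k \<eta> - c) * (\<eta> - (p + q) / 2)) has_integral M) {p..q}"
  using has_integral_diff[OF kernel_ints(2) mid_has_integral[of c]]
  by (simp add: algebra_simps)

private lemma const_int: "((\<lambda>\<eta>. c) has_integral (q - p) * c) {p..q}"
  using has_integral_const_real[of c p q] pq by simp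

private lemma linear_int: "((\<lambda>\<eta>. c * (q - \<eta>)) has_integral c * (q - p)\<^sup>2 / 2) {p..q}"
proof -
  have "((\<lambda>\<eta>. c * (q - \<eta>)) has_integral (- c / 2 * (q - q)\<^sup>2 - - c / 2 * (q - p)\<^sup>2)) {p..q}"
    using pq by (intro fundamental_theorem_of_calculus)
      (auto intro!: derivative_eq_intros simp: has_real_derivative_iff_has_vector_derivative[symmetric]
        field_simps)
  then show ?thesis by simp
qed

lemma kernel_integral_ge: "(q - p) * k p \<le> A"
  by (rule has_integral_le[OF const_int kernel_ints(1)]) (use k_mono pq in auto)

text \<open>After subtracting the midpoint value of the increasing kernel, both factors of the
  integrand change sign at the midpoint together.\<close>

lemma kernel_moment_nonneg: "0 \<le> M"
proof (rule has_integral_nonneg[OF moment_shift[of "k ((p + q) / 2)"]])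
  fix \<eta> assume e: "\<eta> \<in> {p..q}"
  have m: "(p + q) / 2 < s" using pq by simp
  show "0 \<le> (k \<eta> - k ((p + q) / 2)) * (\<eta> - (p + q) / 2)"
  proof (cases "\<eta> \<le> (p + q) / 2")
    case True
    then have "k \<eta> \<le> k ((p + q) / 2)" by (intro k_mono m)
    then show ?thesis using True by (intro mult_nonpos_nonpos) auto
  next
    case False
    then have "k ((p + q) / 2) \<le> k \<eta>" using e pq by (intro k_mono) auto
    then show ?thesis using False by simp
  qed
qed

text \<open>Subtracting the left end value makes the kernel factor nonnegative, and the distance to
  the midpoint is at most half the length.\<close>

lemma kernel_moment_le_left: "M \<le> (q - p) / 2 * (A - (q - p) * k p)"
proof (rule has_integral_le[OF moment_shift[of "k p"]])
  show "((\<lambda>\<eta>. (q - p) / 2 * (k \<eta> - k p)) has_integral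
         (q - p) / 2 * (A - (q - p) * k p)) {p..q}"
    by (intro has_integral_mult_right has_integral_diff kernel_ints const_int)
  fix \<eta> assume e: "\<eta> \<in> {p..q}"
  then have "k p \<le> k \<eta>" using pq by (intro k_mono) auto
  then have "(\<eta> - (p + q) / 2) * (k \<eta> - k p) \<le> (q - p) / 2 * (k \<eta> - k p)"
    using e by (intro mult_right_mono) (auto simp: field_simps)
  then show "(k \<eta> - k p) * (\<eta> - (p + q) / 2) \<le> (q - p) / 2 * (k \<eta> - k p)"
    by (simp add: mult.commute)
qed

text \<open>Subtracting the right end value, the tangent at \<open>q\<close> bounds the drop of the
  kernel by slope times \<open>q - \<eta>\<close>. The slope at \<open>q\<close> reappears as the
  slope at the left end of the next cell in \<open>kernel_integral_le_slope\<close>; this match lets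
  the two bounds be compared.\<close>

lemma kernel_moment_le_slope: "M \<le> \<alpha> * (s - q) powr (-\<alpha> - 1) * (q - p) ^ 3 / 4"
proof -
  define m where "m = \<alpha> * (s - q) powr (-\<alpha> - 1)"
  have m0: "0 \<le> m" using \<alpha> by (simp add: m_def)
  have i: "((\<lambda>\<eta>. (q - p) / 2 * (m * (q - \<eta>))) has_integral m * (q - p) ^ 3 / 4) {p..q}"
    using linear_int[of "(q - p) / 2 * m"] by (simp add: power2_eq_square power3_eq_cube mult_ac)
  have "M \<le> m * (q - p) ^ 3 / 4"
  proof (rule has_integral_le[OF moment_shift[of "k q"] i])
    fix \<eta> assume e: "\<eta> \<in> {p..q}"
    have 1: "k \<eta> \<le> k q" using e pq by (intro k_mono) auto
    have 2: "k q - k \<eta> \<le> m * (q - \<eta>)"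
      using powr_kernel_tangent[of \<alpha> q s \<eta>] e pq \<alpha> by (simp add: m_def algebra_simps)
    have "(k q - k \<eta>) * ((p + q) / 2 - \<eta>) \<le> (k q - k \<eta>) * ((q - p) / 2)"
      using 1 e by (intro mult_left_mono) (auto simp: field_simps)
    also have "\<dots> \<le> m * (q - \<eta>) * ((q - p) / 2)"
      using 2 pq by (intro mult_right_mono) auto
    finally show "(k \<eta> - k q) * (\<eta> - (p + q) / 2) \<le> (q - p) / 2 * (m * (q - \<eta>))"
      by (simp add: algebra_simps)
  qed
  then show ?thesis by (simp add: m_def)
qed

text \<open>The tangent at \<open>\<eta>\<close>, evaluated at \<open>q\<close>, bounds the kernel
  at \<open>\<eta>\<close> from above; its slope is replaced by the smaller slope at
  \<open>p\<close>, and the resulting linear function is integrated.\<close>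

lemma kernel_integral_le_slope:
  "A \<le> (q - p) * k q - \<alpha> * (s - p) powr (-\<alpha> - 1) * (q - p)\<^sup>2 / 2"
proof -
  define m where "m = \<alpha> * (s - p) powr (-\<alpha> - 1)"
  have i: "((\<lambda>\<eta>. k q - m * (q - \<eta>)) has_integral (q - p) * k q - m * (q - p)\<^sup>2 / 2) {p..q}"
    by (intro has_integral_diff const_int linear_int)
  have "A \<le> (q - p) * k q - m * (q - p)\<^sup>2 / 2"
  proof (rule has_integral_le[OF kernel_ints(1) i])
    fix \<eta> assume e: "\<eta> \<in> {p..q}"
    have "m \<le> \<alpha> * (s - \<eta>) powr (-\<alpha> - 1)" unfolding m_def
      using e pq \<alpha> by (intro mult_left_mono powr_mono2') auto
    then have "m * (q - \<eta>) \<le> \<alpha> * (s - \<eta>) powr (-\<alpha> - 1) * (q - \<eta>)"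
      using e by (intro mult_right_mono) auto
    with powr_kernel_tangent[of \<alpha> \<eta> s q] e pq \<alpha> show "k \<eta> \<le> k q - m * (q - \<eta>)"
      by simp
  qed
  then show ?thesis by (simp add: m_def)
qed

end

section \<open>Weights of the \<open>L2-1\<^sub>\<sigma>\<close> operator on the graded mesh\<close>

lemma step_pos:
  assumes "0 < T" "1 \<le> r" "1 \<le> N" "1 \<le> n"
  shows "0 < step T r N n"
proof -
  have "(real (n - 1) / real N) powr r < (real n / real N) powr r"
    using assms by (intro powr_less_mono2 divide_strict_right_mono) auto
  then show ?thesis using assms by (simp add: step_def node_def)
qed

text \<open>Nondecreasing steps amount to midpoint convexity of \<open>x powr r\<close>, which holds
  because \<open>r\<close> is at least 1.\<close>

lemma step_mono:
  assumes "0 < T" "1 \<le> r" "1 \<le> N" "1 \<le> n"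
  shows "step T r N n \<le> step T r N (n + 1)"
proof -
  define h where "h m = (real m / real N) powr r" for m
  have "2 * h n \<le> h (n - 1) + h (n + 1)"
  proof (cases "n = 1")
    case True
    \<comment> \<open>At \<open>n = 1\<close> the left neighbour is the origin and the claim reduces
      to \<open>2 \<le> 2 powr r\<close>.\<close>
    have "2 powr 1 \<le> (2::real) powr r" using assms by (intro powr_mono) auto
    then have "2 * (1 / real N) powr r \<le> (2 powr r) * (1 / real N) powr r"
      by (intro mult_right_mono) auto
    also have "\<dots> = (2 / real N) powr r"
      by (subst powr_mult[symmetric]) auto
    finally show ?thesis using True assms by (simp add: h_def)
  next
    case False
    have eq: "(1 - 1 / 2) * (real (n - 1) / real N) + 1 / 2 * (real (n + 1) / real N) = real n / real N"
      using assms by (simp add: field_simps of_nat_diff)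
    have "(real n / real N) powr r \<le> (1 - 1 / 2) * (real (n - 1) / real N) powr r
        + 1 / 2 * (real (n + 1) / real N) powr r"
      using convex_onD[OF powr_convex[OF assms(2)], of "1/2" "real (n - 1) / real N"
          "real (n + 1) / real N"] False assms
      unfolding real_scaleR_def eq by auto
    then show ?thesis by (simp add: h_def)
  qed
  then have "T * (2 * h n) \<le> T * (h (n - 1) + h (n + 1))"
    using assms by (intro mult_left_mono) auto
  then show ?thesis
    by (simp add: step_def node_def h_def algebra_simps)
qed

lemma node_mono:
  assumes "0 < T" "1 \<le> r" "1 \<le> N" "i \<le> j"
  shows "node T r N i \<le> node T r N j"
  unfolding node_def using assms by (intro mult_left_mono powr_mono2 divide_right_mono) auto

section \<open>Bounds for the weights at a fixed time level \<open>n\<close>\<close>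

context
  fixes \<alpha> T r :: real and N n :: nat
  assumes \<alpha>: "0 < \<alpha>" "\<alpha> < 1" and mesh: "0 < T" "1 \<le> r" "1 \<le> N" "1 \<le> n"
begin

private abbreviation (input) "t \<equiv> node T r N"
private abbreviation (input) "\<tau> \<equiv> step T r N"
private abbreviation (input) "s \<equiv> node_sigma \<alpha> T r N n"
private abbreviation (input) "\<Gamma> \<equiv> Gamma (1 - \<alpha>)"

definition kernel_at :: "nat \<Rightarrow> real" where
  "kernel_at j = (s - t j) powr (-\<alpha>)"

lemma node_sigma_gt: "s - t (n - 1) = (1 - \<alpha> / 2) * \<tau> n" "t (n - 1) < s"
proof -
  show *: "s - t (n - 1) = (1 - \<alpha> / 2) * \<tau> n"
    by (simp add: node_sigma_def step_def Let_def algebra_simps)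
  have "0 < (1 - \<alpha> / 2) * \<tau> n" using step_pos[OF mesh] \<alpha> by simp
  with * show "t (n - 1) < s" by simp
qed

lemma node_sigma_less: "s < t n"
proof -
  have "t n - s = \<alpha> / 2 * \<tau> n"
    by (simp add: node_sigma_def step_def Let_def algebra_simps)
  moreover have "0 < \<alpha> / 2 * \<tau> n" using step_pos[OF mesh] \<alpha> by simp
  ultimately show ?thesis by linarith
qed

private lemma \<Gamma>_pos: "0 < \<Gamma>" using \<alpha> by (intro Gamma_real_pos) simp

private lemma interval:
  assumes "1 \<le> j" "j < n"
  shows "t (j - 1) < t j" "t j < s" "t j - t (j - 1) = \<tau> j" "0 < \<tau> j" "\<tau> j \<le> \<tau> (j + 1)"
    "t (j + 1) - t (j - 1) = \<tau> j + \<tau> (j + 1)"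
proof -
  show 1: "0 < \<tau> j" "\<tau> j \<le> \<tau> (j + 1)" using step_pos step_mono mesh assms by auto
  show 2: "t j - t (j - 1) = \<tau> j" "t (j + 1) - t (j - 1) = \<tau> j + \<tau> (j + 1)"
    by (auto simp: step_def)
  show "t (j - 1) < t j" using 1 2 by simp
  have "t j \<le> t (n - 1)" using assms mesh by (intro node_mono) auto
  then show "t j < s" using node_sigma_gt by simp
qed

private definition "moment j = integral {t (j - 1)..t j} (\<lambda>\<eta>. (s - \<eta>) powr (-\<alpha>) * (\<eta> - node_half T r N j))"

text \<open>The sign is that of the moment. Since the steps do not decrease, the length of the
  double cell in the denominator is at least twice \<open>\<tau> j\<close>, which leaves a bound in
  terms of cell \<open>j\<close> alone.\<close>

private lemma coeff_b_bounds:
  assumes j: "1 \<le> j" "j < n"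
  shows "0 \<le> coeff_b \<alpha> T r N n j" "coeff_b \<alpha> T r N n j \<le> moment j / (\<Gamma> * \<tau> j)"
proof -
  note i = interval[OF j]
  have M: "0 \<le> moment j"
    using kernel_moment_nonneg[OF \<alpha> i(1,2)] by (simp add: moment_def node_half_def)
  have b: "coeff_b \<alpha> T r N n j = 2 / (\<Gamma> * (\<tau> j + \<tau> (j + 1))) * moment j"
    by (simp add: coeff_b_def moment_def i(6)[simplified])
  show "0 \<le> coeff_b \<alpha> T r N n j"
    unfolding b using M \<Gamma>_pos i by (intro mult_nonneg_nonneg divide_nonneg_nonneg) auto
  have "2 / (\<Gamma> * (\<tau> j + \<tau> (j + 1))) \<le> 2 / (\<Gamma> * (2 * \<tau> j))"
    using \<Gamma>_pos i by (intro divide_left_mono mult_left_mono mult_pos_pos) auto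
  then have "2 / (\<Gamma> * (\<tau> j + \<tau> (j + 1))) * moment j \<le> 2 / (\<Gamma> * (2 * \<tau> j)) * moment j"
    using M by (intro mult_right_mono)
  then show "coeff_b \<alpha> T r N n j \<le> moment j / (\<Gamma> * \<tau> j)"
    unfolding b using \<Gamma>_pos i by simp
qed

text \<open>By the left end estimate of the moment, \<open>b\<close> is at most half of the surplus
  of \<open>a\<close> over the claimed lower bound, so subtracting it cannot break that
  bound.\<close>

private lemma coeff_a_minus_b:
  assumes j: "1 \<le> j" "j < n"
  shows "\<tau> j * kernel_at (j - 1) / \<Gamma> \<le> coeff_a \<alpha> T r N n j - coeff_b \<alpha> T r N n j"
proof -
  note i = interval[OF j]
  define A where "A = integral {t (j - 1)..t j} (\<lambda>\<eta>. (s - \<eta>) powr (-\<alpha>))"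
  have a: "coeff_a \<alpha> T r N n j = A / \<Gamma>"
    using j by (simp add: coeff_a_def A_def)
  have A: "\<tau> j * kernel_at (j - 1) \<le> A"
    using kernel_integral_ge[OF \<alpha> i(1,2)]
    unfolding i(3) by (simp add: A_def kernel_at_def)
  have "moment j \<le> \<tau> j / 2 * (A - \<tau> j * kernel_at (j - 1))"
    using kernel_moment_le_left[OF \<alpha> i(1,2)]
    unfolding i(3) by (simp add: A_def moment_def kernel_at_def node_half_def)
  then have "moment j / (\<Gamma> * \<tau> j) \<le> \<tau> j / 2 * (A - \<tau> j * kernel_at (j - 1)) / (\<Gamma> * \<tau> j)"
    using \<Gamma>_pos i by (intro divide_right_mono) auto
  also have "\<dots> = (A - \<tau> j * kernel_at (j - 1)) / (2 * \<Gamma>)"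
    using \<Gamma>_pos i(4) by (simp add: field_simps)
  also have "\<dots> \<le> (A - \<tau> j * kernel_at (j - 1)) / \<Gamma>"
    using \<Gamma>_pos A by (intro divide_left_mono) auto
  finally have "coeff_b \<alpha> T r N n j \<le> (A - \<tau> j * kernel_at (j - 1)) / \<Gamma>"
    using coeff_b_bounds(2)[OF j] by linarith
  then show ?thesis by (simp add: a diff_divide_distrib)
qed

text \<open>Let \<open>m\<close> be the slope of the kernel at the shared node
  \<open>t (j - 1)\<close>. Convexity puts the integral over cell \<open>j\<close> below
  \<open>\<tau> j * kernel_at j\<close> by at least \<open>m * (\<tau> j)\<^sup>2 / 2\<close>, while
  the preceding \<open>b\<close> adds at most \<open>m * (\<tau> (j - 1))\<^sup>2 / 4\<close> before
  division by \<Gamma>, which is no more because the steps do not decrease.\<close>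

private lemma coeff_a_plus_b:
  assumes j: "1 \<le> j" "j < n"
  shows "coeff_a \<alpha> T r N n j + (if j = 1 then 0 else coeff_b \<alpha> T r N n (j - 1))
    \<le> \<tau> j * kernel_at j / \<Gamma>"
proof -
  note i = interval[OF j]
  define A where "A = integral {t (j - 1)..t j} (\<lambda>\<eta>. (s - \<eta>) powr (-\<alpha>))"
  define m where "m = \<alpha> * (s - t (j - 1)) powr (-\<alpha> - 1)"
  have m: "0 \<le> m" using \<alpha> by (simp add: m_def)
  have a: "coeff_a \<alpha> T r N n j = A / \<Gamma>"
    using j by (simp add: coeff_a_def A_def)
  have A: "A \<le> \<tau> j * kernel_at j - m * (\<tau> j)\<^sup>2 / 2"
    using kernel_integral_le_slope[OF \<alpha> i(1,2)]
    unfolding i(3) by (simp add: A_def kernel_at_def m_def)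
  have "(if j = 1 then 0 else coeff_b \<alpha> T r N n (j - 1)) \<le> m * (\<tau> j)\<^sup>2 / 4 / \<Gamma>"
  proof (cases "j = 1")
    case False
    then have j': "1 \<le> j - 1" "j - 1 < n" and [simp]: "Suc (j - 1) = j" using j by auto
    note i' = interval[OF j', simplified]
    have "moment (j - 1) \<le> m * \<tau> (j - 1) ^ 3 / 4"
      using kernel_moment_le_slope[OF \<alpha> i'(1,2)]
      by (simp add: moment_def i' m_def node_half_def)
    then have "moment (j - 1) / (\<Gamma> * \<tau> (j - 1)) \<le> m * \<tau> (j - 1) ^ 3 / 4 / (\<Gamma> * \<tau> (j - 1))"
      using \<Gamma>_pos i' by (intro divide_right_mono) auto
    also have "\<dots> = m * (\<tau> (j - 1))\<^sup>2 / 4 / \<Gamma>"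
      using i'(4) by (simp add: power2_eq_square power3_eq_cube)
    also have "\<dots> \<le> m * (\<tau> j)\<^sup>2 / 4 / \<Gamma>"
      using \<Gamma>_pos i' m by (intro divide_right_mono mult_left_mono power_mono) auto
    finally show ?thesis using coeff_b_bounds(2)[OF j'] False by auto
  qed (use m \<Gamma>_pos in simp)
  also have "\<dots> \<le> m * (\<tau> j)\<^sup>2 / 2 / \<Gamma>"
    using m \<Gamma>_pos by (intro divide_right_mono) auto
  finally have "A / \<Gamma> + (if j = 1 then 0 else coeff_b \<alpha> T r N n (j - 1))
      \<le> (\<tau> j * kernel_at j - m * (\<tau> j)\<^sup>2 / 2) / \<Gamma> + m * (\<tau> j)\<^sup>2 / 2 / \<Gamma>"
    using A \<Gamma>_pos by (intro add_mono divide_right_mono) auto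
  then show ?thesis by (simp add: a diff_divide_distrib)
qed

private lemma step_times_coeff_g:
  assumes "1 \<le> j"
  shows "\<tau> j * coeff_g \<alpha> T r N n j =
     (if n = 1 then coeff_a \<alpha> T r N n j
      else if j = 1 then coeff_a \<alpha> T r N n j - coeff_b \<alpha> T r N n j
      else if j < n then coeff_a \<alpha> T r N n j + coeff_b \<alpha> T r N n (j - 1) - coeff_b \<alpha> T r N n j
      else coeff_a \<alpha> T r N n j + coeff_b \<alpha> T r N n (j - 1))"
  using step_pos[OF mesh(1-3) assms] unfolding coeff_g_def
  by (subst mult.assoc[symmetric]) simp

text \<open>The nonnegative \<open>b\<close> of the preceding cell is discarded here; for the upper
  bound in \<open>coeff_g_le_kernel\<close> it is the term \<open>- b\<close> of the same
  cell.\<close>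

lemma coeff_g_ge_kernel:
  assumes j: "1 \<le> j" "j < n"
  shows "kernel_at (j - 1) / \<Gamma> \<le> coeff_g \<alpha> T r N n j"
proof -
  have "0 \<le> (if j = 1 then 0 else coeff_b \<alpha> T r N n (j - 1))"
    using j coeff_b_bounds(1)[of "j - 1"] by auto
  then have "\<tau> j * kernel_at (j - 1) / \<Gamma> \<le> \<tau> j * coeff_g \<alpha> T r N n j"
    using coeff_a_minus_b[OF j] j
    by (auto simp: step_times_coeff_g split: if_splits)
  then have "\<tau> j * (kernel_at (j - 1) / \<Gamma>) \<le> \<tau> j * coeff_g \<alpha> T r N n j" by simp
  then show ?thesis using interval(4)[OF j] by (rule mult_left_le_imp_le)
qed

lemma coeff_g_le_kernel:
  assumes j: "1 \<le> j" "j < n"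
  shows "coeff_g \<alpha> T r N n j \<le> kernel_at j / \<Gamma>"
proof -
  have "\<tau> j * coeff_g \<alpha> T r N n j \<le> \<tau> j * kernel_at j / \<Gamma>"
    using coeff_a_plus_b[OF j] coeff_b_bounds(1)[OF j] j
    by (auto simp: step_times_coeff_g split: if_splits)
  then have "\<tau> j * coeff_g \<alpha> T r N n j \<le> \<tau> j * (kernel_at j / \<Gamma>)" by simp
  then show ?thesis using interval(4)[OF j] by (rule mult_left_le_imp_le)
qed

text \<open>The last cell ends at the singularity, so its integral is explicit:
  \<open>c powr (1 - \<alpha>) / (1 - \<alpha>)\<close> for the length
  \<open>c = (1 - \<alpha> / 2) * \<tau> n\<close>, that is, \<open>c\<close> times the kernel at
  its left end over \<open>1 - \<alpha>\<close>. With \<sigma> = \<alpha> / 2 the factor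
  \<open>1 - \<alpha>\<close> is the \<open>1 - 2 * \<sigma>\<close> of Alikhanov's
  condition.\<close>

lemma coeff_g_diag_ge_kernel:
  "(1 - \<alpha> / 2) * (kernel_at (n - 1) / \<Gamma>) \<le> (1 - \<alpha>) * coeff_g \<alpha> T r N n n"
proof -
  define c where "c = (1 - \<alpha> / 2) * \<tau> n"
  have \<tau>: "0 < \<tau> n" by (rule step_pos[OF mesh])
  have c: "0 < c" using \<tau> \<alpha> by (simp add: c_def)
  have "integral {t (n - 1)..s} (\<lambda>\<eta>. (s - \<eta>) powr (-\<alpha>)) = c powr (1 - \<alpha>) / (1 - \<alpha>)"
    using powr_kernel_has_integral[OF \<alpha>, of "t (n - 1)" s s] node_sigma_gt \<alpha>
    by (intro integral_unique) (simp add: c_def)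
  moreover have "c powr (1 - \<alpha>) = c * kernel_at (n - 1)"
    unfolding kernel_at_def node_sigma_gt(1) c_def[symmetric]
    using c by (simp add: powr_diff powr_minus divide_inverse)
  ultimately have a: "coeff_a \<alpha> T r N n n = c * kernel_at (n - 1) / (1 - \<alpha>) / \<Gamma>"
    by (simp add: coeff_a_def)
  have "coeff_a \<alpha> T r N n n \<le> \<tau> n * coeff_g \<alpha> T r N n n"
    using \<tau> coeff_b_bounds(1)[of "n - 1"] mesh by (auto simp: step_times_coeff_g)
  then have "(1 - \<alpha>) * (c * kernel_at (n - 1) / (1 - \<alpha>) / \<Gamma>) \<le> (1 - \<alpha>) * (\<tau> n * coeff_g \<alpha> T r N n n)"
    unfolding a using \<alpha> by (intro mult_left_mono) auto
  moreover have "(1 - \<alpha>) * (c * kernel_at (n - 1) / (1 - \<alpha>) / \<Gamma>)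
      = \<tau> n * ((1 - \<alpha> / 2) * (kernel_at (n - 1) / \<Gamma>))"
    using \<alpha> by (simp add: c_def)
  ultimately have "\<tau> n * ((1 - \<alpha> / 2) * (kernel_at (n - 1) / \<Gamma>))
      \<le> \<tau> n * ((1 - \<alpha>) * coeff_g \<alpha> T r N n n)"
    by (simp add: mult.left_commute)
  then show ?thesis using \<tau> by (rule mult_left_le_imp_le)
qed

private lemma coeff_g_diag_ge: "kernel_at (n - 1) / \<Gamma> \<le> coeff_g \<alpha> T r N n n"
proof -
  have "(1 - \<alpha>) * (kernel_at (n - 1) / \<Gamma>) \<le> (1 - \<alpha> / 2) * (kernel_at (n - 1) / \<Gamma>)"
    using \<alpha> \<Gamma>_pos by (intro mult_right_mono) (auto simp: kernel_at_def)
  also note coeff_g_diag_ge_kernel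
  finally show ?thesis by (rule mult_left_le_imp_le) (use \<alpha> in simp)
qed

text \<open>Consecutive weights are separated by the kernel value at the node \<open>t j\<close>
  that their cells share; for the last pair the diagonal bound is used.\<close>

lemma coeff_g_mono:
  assumes j: "1 \<le> j" "j < n"
  shows "coeff_g \<alpha> T r N n j \<le> coeff_g \<alpha> T r N n (j + 1)"
proof (cases "j + 1 = n")
  case True
  then show ?thesis using coeff_g_le_kernel[OF j] coeff_g_diag_ge by auto
next
  case False
  then show ?thesis using coeff_g_le_kernel[OF j] coeff_g_ge_kernel[of "j + 1"] j by auto
qed

text \<open>This is the condition on the two last weights in
  \<open>sigma_average_times_increments\<close>, for \<sigma> = \<alpha> / 2.\<close>

lemma coeff_g_last:
  assumes "2 \<le> n"
  shows "(1 - \<alpha> / 2) * coeff_g \<alpha> T r N n (n - 1) \<le> (1 - \<alpha>) * coeff_g \<alpha> T r N n n"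
proof -
  have "(1 - \<alpha> / 2) * coeff_g \<alpha> T r N n (n - 1) \<le> (1 - \<alpha> / 2) * (kernel_at (n - 1) / \<Gamma>)"
    using assms \<alpha> by (intro mult_left_mono coeff_g_le_kernel) auto
  then show ?thesis using coeff_g_diag_ge_kernel by simp
qed

text \<open>Lying strictly inside the time interval, these are times at which
  \<open>Bochner_L2\<close> provides point values of \<open>f\<close> in the space
  \<open>L2_space\<close>.\<close>

lemma node_sigma_bounds:
  assumes "n \<le> N"
  shows "0 < s" "s < T"
proof -
  have 0: "t 0 = 0" using mesh by (simp add: node_def)
  have "t n \<le> t N" using assms mesh by (intro node_mono) auto
  also have "t N = T" using mesh by (simp add: node_def)
  finally show "s < T" using node_sigma_less by simp
  show "0 < s"
    using node_mono[OF mesh(1-3), of 0 "n - 1"] 0 node_sigma_gt(2) by simp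
qed

text \<open>The distance from the evaluation time to \<open>t 0 = 0\<close> is less than
  \<open>T\<close>, so the kernel at 0 is at least \<open>T powr (-\<alpha>)\<close>. This bound is
  free of \<open>n\<close> and \<open>N\<close>, and the mesh independence of the final constant
  comes from it.\<close>

lemma coeff_g_first_ge:
  assumes "n \<le> N"
  shows "T powr (-\<alpha>) / \<Gamma> \<le> coeff_g \<alpha> T r N n 1"
proof -
  have 0: "t 0 = 0" using mesh by (simp add: node_def)
  have "T powr (-\<alpha>) / \<Gamma> \<le> kernel_at 0 / \<Gamma>"
    using node_sigma_bounds[OF assms] \<alpha> \<Gamma>_pos unfolding kernel_at_def 0
    by (intro divide_right_mono powr_mono2') auto
  also have "\<dots> \<le> coeff_g \<alpha> T r N n 1"
    using coeff_g_ge_kernel[of 1] coeff_g_diag_ge mesh by (cases "n = 1") auto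
  finally show ?thesis .
qed

end

section \<open>Discrete fractional inequalities\<close>

text \<open>Completing the square, each summand equals
  \<open>((S k)\<^sup>2 - (S (k - 1))\<^sup>2) / (2 * g k)\<close>. Since \<open>g\<close>
  increases, the sum dominates its telescoped end term; the correction from the last level is kept
  because the \<sigma>-shift needs it.\<close>

lemma sum_weighted_increments_lower:
  fixes g d :: "nat \<Rightarrow> real"
  assumes "1 \<le> n"
    and pos: "\<And>j. 1 \<le> j \<Longrightarrow> j \<le> n \<Longrightarrow> 0 < g j"
    and mono: "\<And>j. 1 \<le> j \<Longrightarrow> j < n \<Longrightarrow> g j \<le> g (j + 1)"
  defines "S \<equiv> \<lambda>k. \<Sum>j=1..k. g j * d j"
  shows "(S n)\<^sup>2 / (2 * g n) +
      (if n = 1 then 0 else (S (n - 1))\<^sup>2 / (2 * g (n - 1)) - (S (n - 1))\<^sup>2 / (2 * g n))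
    \<le> (\<Sum>k=1..n. S (k - 1) * d k + g k * (d k)\<^sup>2 / 2)"
  using \<open>1 \<le> n\<close> pos mono
proof (induction n rule: dec_induct)
  case base
  then have "0 < g 1" by simp
  then show ?case by (simp add: S_def power2_eq_square)
next
  case (step n)
  let ?R = "\<lambda>n. \<Sum>k=1..n. S (k - 1) * d k + g k * (d k)\<^sup>2 / 2"
  have g: "0 < g n" "0 < g (Suc n)" using step by auto
  \<comment> \<open>The correction in the induction hypothesis is nonnegative and is dropped; only
    the newest one has to survive.\<close>
  have "(if n = 1 then 0 else (S (n - 1))\<^sup>2 / (2 * g (n - 1)) - (S (n - 1))\<^sup>2 / (2 * g n)) \<ge> 0"
  proof (cases "n = 1")
    case False
    then have "0 < g (n - 1)" "g (n - 1) \<le> g n" using step.prems(1)[of "n - 1"] step.prems(2)[of "n - 1"] step.hyps by auto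
    then show ?thesis using False g by (auto intro!: divide_left_mono)
  qed simp
  then have "(S n)\<^sup>2 / (2 * g n) \<le> ?R n" using step by force
  moreover have "S (Suc n) = S n + g (Suc n) * d (Suc n)" by (simp add: S_def)
  then have "(S (Suc n))\<^sup>2 / (2 * g (Suc n)) = (S n)\<^sup>2 / (2 * g (Suc n)) + S n * d (Suc n) + g (Suc n) * (d (Suc n))\<^sup>2 / 2"
    using g by (simp add: power2_eq_square field_simps)
  ultimately show ?case using step.hyps by simp
qed

text \<open>With \<open>d\<^sub>j = v\<^sub>j - v\<^sub>j\<^sub>-\<^sub>1\<close> and \<open>S\<^sub>k = \<Sum>\<^sub>j\<^sub>\<le>\<^sub>k g\<^sub>j d\<^sub>j\<close>, Abel summation
  turns the difference of the two sides into a quadratic form in \<open>S\<^sub>n\<close> and \<open>S\<^sub>n\<^sub>-\<^sub>1\<close>.\<close>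

lemma sigma_average_times_increments:
  fixes g v :: "nat \<Rightarrow> real" and \<sigma> :: real
  assumes n: "1 \<le> n" and \<sigma>: "0 \<le> \<sigma>" "\<sigma> < 1 / 2"
    and pos: "\<And>j. 1 \<le> j \<Longrightarrow> j \<le> n \<Longrightarrow> 0 < g j"
    and mono: "\<And>j. 1 \<le> j \<Longrightarrow> j < n \<Longrightarrow> g j \<le> g (j + 1)"
    and last: "2 \<le> n \<Longrightarrow> (1 - \<sigma>) * g (n - 1) \<le> (1 - 2 * \<sigma>) * g n"
  shows "(\<Sum>j=1..n. g j * ((v j)\<^sup>2 - (v (j - 1))\<^sup>2)) / 2
    \<le> (\<Sum>j=1..n. g j * (v j - v (j - 1))) * ((1 - \<sigma>) * v n + \<sigma> * v (n - 1))"
proof -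
  define d where "d j = v j - v (j - 1)" for j
  define S where "S k = (\<Sum>j=1..k. g j * d j)" for k
  have g: "0 < g n" using pos n by auto
  \<comment> \<open>Abel summation: \<open>v m - v j\<close> is the sum of the later increments, so
    exchanging the order collects the partial sums \<open>S (k - 1)\<close> in front of
    \<open>d k\<close>.\<close>
  have "(\<Sum>j=1..m. g j * d j * (v m - v j)) = (\<Sum>k=1..m. S (k - 1) * d k)" for m
  proof (induction m)
    case (Suc m)
    have "(\<Sum>j=1..Suc m. g j * d j * (v (Suc m) - v j)) =
        (\<Sum>j=1..m. g j * d j * (v m - v j) + g j * d j * d (Suc m))"
      by (simp add: d_def algebra_simps)
    also have "\<dots> = (\<Sum>j=1..m. g j * d j * (v m - v j)) + S m * d (Suc m)"
      unfolding S_def sum_distrib_right by (rule sum.distrib)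
    finally show ?case using Suc.IH by simp
  qed simp
  note abel = this
  have "S n * v n - (\<Sum>j=1..n. g j * ((v j)\<^sup>2 - (v (j - 1))\<^sup>2)) / 2
     = (\<Sum>j=1..n. g j * d j * (v n - v j) + g j * (d j)\<^sup>2 / 2)"
    unfolding S_def sum_distrib_right sum_divide_distrib sum_subtractf[symmetric]
    by (rule sum.cong) (auto simp: d_def power2_eq_square field_simps)
  also have "\<dots> = (\<Sum>k=1..n. S (k - 1) * d k + g k * (d k)\<^sup>2 / 2)"
    by (simp only: sum.distrib abel)
  also have "\<dots> \<ge> (S n)\<^sup>2 / (2 * g n) +
      (if n = 1 then 0 else (S (n - 1))\<^sup>2 / (2 * g (n - 1)) - (S (n - 1))\<^sup>2 / (2 * g n))"
    unfolding S_def by (rule sum_weighted_increments_lower[of n g d, OF n pos mono])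
  finally have 1: "(S n)\<^sup>2 / (2 * g n) +
      (if n = 1 then 0 else (S (n - 1))\<^sup>2 / (2 * g (n - 1)) - (S (n - 1))\<^sup>2 / (2 * g n))
      \<le> S n * v n - (\<Sum>j=1..n. g j * ((v j)\<^sup>2 - (v (j - 1))\<^sup>2)) / 2" .
  have "S n = S (n - 1) + g n * d n"
    using n by (cases n) (auto simp: S_def)
  then have d: "d n = (S n - S (n - 1)) / g n" using g by (simp add: field_simps)
  \<comment> \<open>Passing from \<open>v n\<close> to the \<sigma>-average costs
    \<open>\<sigma> * S n * d n\<close>, which the lower bound just obtained has to cover.\<close>
  have "\<sigma> * S n * d n \<le> (S n)\<^sup>2 / (2 * g n) +
      (if n = 1 then 0 else (S (n - 1))\<^sup>2 / (2 * g (n - 1)) - (S (n - 1))\<^sup>2 / (2 * g n))"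
  proof (cases "n = 1")
    case True
    have "\<sigma> * (S n)\<^sup>2 \<le> 1 / 2 * (S n)\<^sup>2" using \<sigma> by (intro mult_right_mono) auto
    then have "\<sigma> * (S n)\<^sup>2 / g n \<le> 1 / 2 * (S n)\<^sup>2 / g n" using g by (intro divide_right_mono) auto
    moreover have "S (n - 1) = 0" using True by (simp add: S_def)
    ultimately show ?thesis unfolding d using True by (simp add: power2_eq_square)
  next
    case False
    \<comment> \<open>Multiplied by \<open>2 * g n\<close>, the claim is nonnegativity of \<open>(1
      - 2 * \<sigma>) * x\<^sup>2 + 2 * \<sigma> * x * y + (g n / h - 1) * y\<^sup>2\<close>. Its
      discriminant condition, proved next, follows from the hypothesis on the last two weights and
      \<open>(1 - \<sigma>)\<^sup>2 \<le> 1 - \<sigma>\<close>.\<close>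
    define x y h where "x = S n" and "y = S (n - 1)" and "h = g (n - 1)"
    have h: "0 < h" "(1 - \<sigma>) * h \<le> (1 - 2 * \<sigma>) * g n"
      using pos[of "n - 1"] last n False by (auto simp: h_def)
    have "\<sigma>\<^sup>2 \<le> (1 - 2 * \<sigma>) * (g n / h - 1)"
    proof -
      have "(1 - \<sigma>)\<^sup>2 * h \<le> (1 - \<sigma>) * h"
        using \<sigma> h by (intro mult_right_mono) (auto simp: power2_eq_square mult_left_le_one_le)
      with h have "(1 - \<sigma>)\<^sup>2 * h \<le> (1 - 2 * \<sigma>) * g n" by linarith
      then have "(1 - \<sigma>)\<^sup>2 \<le> (1 - 2 * \<sigma>) * g n / h"
        using h by (simp add: pos_le_divide_eq)
      moreover have "(1 - \<sigma>)\<^sup>2 = (1 - 2 * \<sigma>) + \<sigma>\<^sup>2"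
        by (simp add: power2_eq_square algebra_simps)
      moreover have "(1 - 2 * \<sigma>) * (g n / h - 1) = (1 - 2 * \<sigma>) * g n / h - (1 - 2 * \<sigma>)"
        by (simp add: right_diff_distrib)
      ultimately show ?thesis by linarith
    qed
    \<comment> \<open>The square is completed after multiplying the form by the positive number
      \<open>1 - 2 * \<sigma>\<close>.\<close>
    then have "0 \<le> ((1 - 2 * \<sigma>) * x + \<sigma> * y)\<^sup>2 + ((1 - 2 * \<sigma>) * (g n / h - 1) - \<sigma>\<^sup>2) * y\<^sup>2"
      by simp
    moreover have "((1 - 2 * \<sigma>) * x + \<sigma> * y)\<^sup>2 + ((1 - 2 * \<sigma>) * (R - 1) - \<sigma>\<^sup>2) * y\<^sup>2
        = (1 - 2 * \<sigma>) * ((1 - 2 * \<sigma>) * x\<^sup>2 + 2 * \<sigma> * x * y + (R - 1) * y\<^sup>2)" for R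
      by (simp add: power2_eq_square algebra_simps)
    ultimately have "0 \<le> (1 - 2 * \<sigma>) * x\<^sup>2 + 2 * \<sigma> * x * y + (g n / h - 1) * y\<^sup>2"
      using \<sigma> by (simp add: zero_le_mult_iff)
    then have "0 \<le> ((1 - 2 * \<sigma>) * x\<^sup>2 + 2 * \<sigma> * x * y + (g n / h - 1) * y\<^sup>2) / (2 * g n)"
      using g by simp
    also have "\<dots> = ((1 - 2 * \<sigma>) * x\<^sup>2 + 2 * \<sigma> * x * y) / (2 * g n) + (g n / h - 1) * y\<^sup>2 / (2 * g n)"
      by (simp add: add_divide_distrib)
    also have "(g n / h - 1) * y\<^sup>2 / (2 * g n) = y\<^sup>2 / (2 * h) - y\<^sup>2 / (2 * g n)"
      using g by (simp add: left_diff_distrib diff_divide_distrib)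
    also have "((1 - 2 * \<sigma>) * x\<^sup>2 + 2 * \<sigma> * x * y) / (2 * g n)
        = x\<^sup>2 / (2 * g n) - \<sigma> * x * ((x - y) / g n)"
      using g by (simp add: field_simps power2_eq_square)
    finally show ?thesis using False by (simp add: d x_def y_def h_def)
  qed
  with 1 have "(\<Sum>j=1..n. g j * ((v j)\<^sup>2 - (v (j - 1))\<^sup>2)) / 2 \<le> S n * v n - \<sigma> * S n * d n"
    by linarith
  also have "\<dots> = S n * ((1 - \<sigma>) * v n + \<sigma> * v (n - 1))"
    by (simp add: d_def algebra_simps)
  finally show ?thesis by (simp add: S_def d_def)
qed

text \<open>A discrete maximum principle. Abel summation expresses \<open>g n n * w n\<close>
  through \<open>K\<close> and earlier values with nonnegative coefficients of total
  \<open>g n n\<close>; strong induction bounds all earlier values except \<open>w 0\<close> by the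
  claimed bound.\<close>

lemma discrete_comparison:
  fixes g :: "nat \<Rightarrow> nat \<Rightarrow> real" and w :: "nat \<Rightarrow> real"
  assumes c: "0 < c" "\<And>n. 1 \<le> n \<Longrightarrow> n \<le> N \<Longrightarrow> c \<le> g n 1"
    and mono: "\<And>n j. 1 \<le> j \<Longrightarrow> j < n \<Longrightarrow> n \<le> N \<Longrightarrow> g n j \<le> g n (j + 1)"
    and K: "0 \<le> K" "\<And>n. 1 \<le> n \<Longrightarrow> n \<le> N \<Longrightarrow> (\<Sum>j=1..n. g n j * (w j - w (j - 1))) \<le> K"
    and "n \<le> N"
  shows "w n \<le> w 0 + K / c"
  using \<open>n \<le> N\<close>
proof (induction n rule: less_induct)
  case (less n)
  show ?case
  proof (cases "n = 0")
    case False
    then have n: "1 \<le> n" "n \<le> N" using less.prems by auto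
    let ?B = "w 0 + K / c"
    have abel: "(\<Sum>j=1..m. h j * (w j - w (j - 1)))
        = h m * w m - h 1 * w 0 - (\<Sum>j=1..<m. (h (j + 1) - h j) * w j)" if "1 \<le> m" for m h
      using that by (induction m rule: dec_induct) (auto simp: algebra_simps)
    have tele: "(\<Sum>j=1..<m. h (j + 1) - h j) = h m - h 1" if "1 \<le> m" for m and h :: "nat \<Rightarrow> real"
      using that by (induction m rule: dec_induct) auto
    have g1: "0 < g n 1" using c n by fastforce
    have "g n 1 \<le> g n m" if "1 \<le> m" "m \<le> n" for m
      using that
    proof (induction m rule: dec_induct)
      case (step m)
      then show ?case using mono[of m n] n by simp
    qed simp
    then have gn: "0 < g n n" using g1 n by fastforce
    have "(\<Sum>j=1..<n. (g n (j + 1) - g n j) * w j) \<le> (\<Sum>j=1..<n. (g n (j + 1) - g n j) * ?B)"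
      using less mono n by (intro sum_mono mult_left_mono) auto
    also have "\<dots> = (g n n - g n 1) * ?B"
      using tele[OF n(1), of "g n"] by (simp add: sum_distrib_right[symmetric])
    finally have "g n n * w n \<le> K + g n 1 * w 0 + (g n n - g n 1) * ?B"
      using K(2)[OF n] abel[OF n(1), of "g n"] by linarith
    also have "\<dots> = g n n * ?B + (K - g n 1 * (K / c))" by (simp add: algebra_simps)
    \<comment> \<open>The bound exceeds \<open>w 0\<close> by \<open>K / c\<close>, and
      \<open>w 0\<close> carries the weight \<open>g n 1\<close>, at least \<open>c\<close>; this
      gain pays for \<open>K\<close>.\<close>
    also have "K - g n 1 * (K / c) \<le> 0"
    proof -
      have "c * (K / c) \<le> g n 1 * (K / c)" using c K n by (intro mult_right_mono) auto
      then show ?thesis using c by simp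
    qed
    finally have "g n n * w n \<le> g n n * ?B" by simp
    then show ?thesis using gn by simp
  qed (use c K in simp)
qed

section \<open>Smooth bump functions\<close>

lemma Ck_on_Suc_imp: "Ck_on (Suc k) UNIV f \<Longrightarrow> Ck_on k UNIV f"
proof (induction k arbitrary: f)
  case 0
  then show ?case by (simp add: differentiable_imp_continuous_on)
next
  case (Suc k)
  then show ?case by (metis Ck_on.simps(2))
qed

lemma Ck_on_const [simp]: "Ck_on k UNIV (\<lambda>_. c)"
  by (induction k arbitrary: c) auto

lemma frechet_derivative_eqI: "(f has_derivative f') (at x) \<Longrightarrow> frechet_derivative f (at x) = f'"
  using frechet_derivative_at by metis

lemma differentiable_on_UNIV_has_derivative:
  "f differentiable_on UNIV \<Longrightarrow> (f has_derivative frechet_derivative f (at x)) (at x)"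
  by (simp add: differentiable_on_def frechet_derivative_works)

lemma Ck_on_lincomb:
  assumes "Ck_on k UNIV f" "Ck_on k UNIV g"
  shows "Ck_on k UNIV (\<lambda>x. c * f x + d * g x)"
  using assms
proof (induction k arbitrary: f g)
  case 0
  then show ?case by (auto intro!: continuous_intros)
next
  case (Suc k)
  from Suc.prems have "f differentiable_on UNIV" "g differentiable_on UNIV" by simp_all
  then have "((\<lambda>x. c * f x + d * g x) has_derivative (\<lambda>h. c * frechet_derivative f (at x) h
      + d * frechet_derivative g (at x) h)) (at x)" for x
    by (intro has_derivative_add has_derivative_mult_right differentiable_on_UNIV_has_derivative)
  note D = this
  have "(\<lambda>x. c * f x + d * g x) differentiable_on UNIV"
    using D by (auto simp: differentiable_on_def differentiable_def)
  then show ?case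
    using Suc by (simp add: frechet_derivative_eqI[OF D])
qed

lemma Ck_on_mult:
  assumes "Ck_on k UNIV f" "Ck_on k UNIV g"
  shows "Ck_on k UNIV (\<lambda>x. f x * g x)"
  using assms
proof (induction k arbitrary: f g)
  case 0
  then show ?case by (auto intro!: continuous_intros)
next
  case (Suc k)
  from Suc.prems have "f differentiable_on UNIV" "g differentiable_on UNIV" by simp_all
  then have "((\<lambda>x. f x * g x) has_derivative (\<lambda>h. f x * frechet_derivative g (at x) h
      + frechet_derivative f (at x) h * g x)) (at x)" for x
    by (intro has_derivative_mult differentiable_on_UNIV_has_derivative)
  note D = this
  have "(\<lambda>x. f x * g x) differentiable_on UNIV"
    using D by (auto simp: differentiable_on_def differentiable_def)
  moreover have "Ck_on k UNIV (\<lambda>x. f x * frechet_derivative g (at x) i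
      + frechet_derivative f (at x) i * g x)" if "i \<in> Basis" for i
  proof -
    have "Ck_on k UNIV f" "Ck_on k UNIV g" using Suc.prems[THEN Ck_on_Suc_imp] .
    moreover have "Ck_on k UNIV (\<lambda>x. frechet_derivative f (at x) i)"
      "Ck_on k UNIV (\<lambda>x. frechet_derivative g (at x) i)"
      using Suc.prems that by simp_all
    ultimately have "Ck_on k UNIV (\<lambda>x. 1 * (f x * frechet_derivative g (at x) i)
        + 1 * (frechet_derivative f (at x) i * g x))"
      by (intro Ck_on_lincomb Suc.IH)
    then show ?thesis by simp
  qed
  ultimately show ?case
    by (simp add: frechet_derivative_eqI[OF D])
qed

lemma Ck_on_prod:
  assumes "finite I" "\<And>i. i \<in> I \<Longrightarrow> Ck_on k UNIV (f i)"
  shows "Ck_on k UNIV (\<lambda>x. \<Prod>i\<in>I. f i x)"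
  using assms by (induction I rule: finite_induct) (auto intro: Ck_on_mult)

text \<open>Derivatives of \<open>t \<mapsto> exp (-c / t)\<close>, extended by zero to \<open>t \<le> 0\<close>, stay within the family
  with polynomial factors in \<open>1 / t\<close>.\<close>

definition flat_exp :: "real poly \<Rightarrow> real \<Rightarrow> real \<Rightarrow> real" where
  "flat_exp p c t = (if 0 < t then poly p (1 / t) * exp (- c / t) else 0)"

text \<open>With \<open>y = 1 / t\<close> this is the decay of a polynomial times
  \<open>exp (- (c * y))\<close> at infinity, checked monomial by monomial.\<close>

lemma flat_exp_tendsto_0:
  assumes "0 < c"
  shows "(flat_exp p c \<longlongrightarrow> 0) (at_right 0)"
proof -
  have *: "((\<lambda>y::real. y ^ k * exp (- (c * y))) \<longlongrightarrow> 0) at_top" for k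
  proof -
    have "filterlim (\<lambda>y. c * y) at_top at_top"
      using assms by (intro filterlim_tendsto_pos_mult_at_top[OF tendsto_const] filterlim_ident)
    from filterlim_compose[OF tendsto_power_div_exp_0 this, of k]
    have "((\<lambda>y. (c * y) ^ k / exp (c * y) / c ^ k) \<longlongrightarrow> 0 / c ^ k) at_top"
      using assms by (intro tendsto_divide) auto
    then show ?thesis
      using assms by (simp add: power_mult_distrib exp_minus field_simps)
  qed
  have "((\<lambda>y. \<Sum>k\<le>degree p. coeff p k * (y ^ k * exp (- (c * y)))) \<longlongrightarrow>
      (\<Sum>k\<le>degree p. coeff p k * 0)) at_top"
    by (intro tendsto_intros *)
  then have "((\<lambda>y. poly p y * exp (- (c * y))) \<longlongrightarrow> 0) at_top"
    by (simp add: poly_altdef sum_distrib_right mult.assoc)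
  then have "((\<lambda>t. poly p (inverse t) * exp (- (c * inverse t))) \<longlongrightarrow> 0) (at_right 0)"
    using filterlim_compose filterlim_inverse_at_top_right by blast
  then show ?thesis
    by (rule Lim_transform_eventually)
      (auto intro!: eventually_mono[OF eventually_at_right_less] simp: flat_exp_def divide_inverse)
qed

text \<open>The chain rule for \<open>1 / t\<close> produces the factor
  \<open>1 / t\<^sup>2\<close>, that is, multiplication of the polynomial by the square of the
  variable.\<close>

lemma flat_exp_has_derivative:
  assumes "0 < c"
  shows "(flat_exp p c has_real_derivative flat_exp ([:0, 0, 1:] * (smult c p - pderiv p)) c t) (at t)"
proof (rule linorder_cases[of t 0])
  assume t: "t < 0"
  have "((\<lambda>_. 0) has_real_derivative 0) (at t)" by simp
  then have "(flat_exp p c has_real_derivative 0) (at t)"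
    by (rule has_field_derivative_transform_within_open[of _ _ _ "{..<0}"])
      (use t in \<open>auto simp: flat_exp_def\<close>)
  then show ?thesis using t by (simp add: flat_exp_def)
next
  assume t: "0 < t"
  have "((\<lambda>t. poly p (1 / t) * exp (- c / t)) has_real_derivative
      poly p (1 / t) * (exp (- c / t) * (c / t\<^sup>2)) + (poly (pderiv p) (1 / t) * (- 1 / t\<^sup>2)) * exp (- c / t))
      (at t)"
    using t by (auto intro!: derivative_eq_intros DERIV_chain2[OF poly_DERIV] simp: power2_eq_square)
  then have "(flat_exp p c has_real_derivative
      poly p (1 / t) * (exp (- c / t) * (c / t\<^sup>2)) + (poly (pderiv p) (1 / t) * (- 1 / t\<^sup>2)) * exp (- c / t))
      (at t)"
    by (rule has_field_derivative_transform_within_open[of _ _ _ "{0<..}"])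
      (use t in \<open>auto simp: flat_exp_def\<close>)
  then show ?thesis using t
    by (simp add: flat_exp_def power2_eq_square field_simps)
next
  assume t: "t = 0"
  \<comment> \<open>At the origin the difference quotient from the right again belongs to the
    family, with the polynomial multiplied by the variable.\<close>
  have "((\<lambda>h. flat_exp p c h / h) \<longlongrightarrow> 0) (at_right 0)"
    using flat_exp_tendsto_0[OF assms, of "[:0, 1:] * p"]
    by (rule Lim_transform_eventually)
      (auto intro!: eventually_mono[OF eventually_at_right_less] simp: flat_exp_def)
  moreover have "((\<lambda>h. flat_exp p c h / h) \<longlongrightarrow> 0) (at_left 0)"
    by (rule Lim_transform_eventually[OF tendsto_const])
      (auto simp: flat_exp_def eventually_at_filter)
  ultimately have "((\<lambda>h. flat_exp p c h / h) \<longlongrightarrow> 0) (at 0)"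
    by (simp add: filterlim_split_at)
  then show ?thesis using t
    by (simp add: flat_exp_def DERIV_def)
qed

text \<open>Differentiation replaces \<open>p\<close> by another polynomial and adds a constant
  factor, so the induction on the order runs over all \<open>p\<close> at once.\<close>

lemma Ck_on_flat_exp_affine:
  fixes v :: "'a::euclidean_space"
  assumes "0 < c"
  shows "Ck_on k UNIV (\<lambda>x. flat_exp p c (v \<bullet> x + b))"
proof (induction k arbitrary: p)
  let ?q = "\<lambda>p. [:0, 0, 1:] * (smult c p - pderiv p)"
  have D: "((\<lambda>x. flat_exp p c (v \<bullet> x + b)) has_derivative
      (\<lambda>h. flat_exp (?q p) c (v \<bullet> x + b) * (v \<bullet> h))) (at x)" for p x
  proof -
    have "((\<lambda>x. v \<bullet> x + b) has_derivative (\<lambda>h. v \<bullet> h)) (at x)"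
      by (auto intro!: derivative_eq_intros)
    from has_derivative_compose[OF this
        flat_exp_has_derivative[OF assms, of p "v \<bullet> x + b", unfolded has_field_derivative_def]]
    show ?thesis .
  qed
  then have diff: "(\<lambda>x. flat_exp p c (v \<bullet> x + b)) differentiable_on UNIV" for p
    by (auto simp: differentiable_on_def differentiable_def)
  {
    case 0
    then show ?case using diff by (simp add: differentiable_imp_continuous_on)
  next
    case (Suc k)
    have "Ck_on k UNIV (\<lambda>x. flat_exp (?q p) c (v \<bullet> x + b) * (v \<bullet> i))" for i
      using Ck_on_mult[OF Suc Ck_on_const] .
    then show ?case
      unfolding Ck_on.simps frechet_derivative_eqI[OF D] using diff by blast
  }
qed

section \<open>Smooth bumps supported in boxes\<close>

lemma test_functionI:
  assumes "smooth_on UNIV \<phi>" "compact K" "K \<subseteq> \<Omega>" "\<And>x. x \<notin> K \<Longrightarrow> \<phi> x = 0"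
  shows "\<phi> \<in> test_functions \<Omega>"
  unfolding test_functions_def mem_Collect_eq
  by (intro conjI exI[of _ K] allI impI assms)

text \<open>Each coordinate contributes one flat factor per face. The parameter \<open>c\<close>
  controls steepness: as it tends to 0, the bumps tend pointwise to the indicator of the open
  box.\<close>

definition box_bump :: "'a::euclidean_space \<Rightarrow> 'a \<Rightarrow> real \<Rightarrow> 'a \<Rightarrow> real" where
  "box_bump p q c x = (\<Prod>i\<in>Basis. flat_exp 1 c (i \<bullet> x - i \<bullet> p) * flat_exp 1 c (i \<bullet> q - i \<bullet> x))"

lemma smooth_box_bump: "0 < c \<Longrightarrow> smooth_on UNIV (box_bump p q c)"
proof -
  assume c: "0 < c"
  have "Ck_on k UNIV (\<lambda>x. flat_exp 1 c (i \<bullet> x - i \<bullet> p))"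
    "Ck_on k UNIV (\<lambda>x. flat_exp 1 c (i \<bullet> q - i \<bullet> x))" for k i
    using Ck_on_flat_exp_affine[OF c, of k 1 i "- (i \<bullet> p)"]
      Ck_on_flat_exp_affine[OF c, of k 1 "- i" "i \<bullet> q"] by simp_all
  then show ?thesis
    unfolding smooth_on_def box_bump_def[abs_def] by (intro allI Ck_on_prod Ck_on_mult) simp_all
qed

lemma box_bump_bounds:
  assumes "0 < c"
  shows "0 \<le> box_bump p q c x" "box_bump p q c x \<le> 1"
proof -
  have "0 \<le> flat_exp 1 c t \<and> flat_exp 1 c t \<le> 1" for t
    using assms by (auto simp: flat_exp_def)
  then show "0 \<le> box_bump p q c x" "box_bump p q c x \<le> 1"
    unfolding box_bump_def by (auto intro!: prod_nonneg prod_le_1 mult_le_one)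
qed

lemma box_bump_eq_0: "x \<notin> box p q \<Longrightarrow> box_bump p q c x = 0"
  by (auto simp: box_bump_def box_def flat_exp_def inner_commute not_less intro!: bexI)

lemma box_bump_tendsto:
  "(\<lambda>n. box_bump p q (1 / real (Suc n)) x) \<longlonglongrightarrow> indicator (box p q) x"
proof (cases "x \<in> box p q")
  case True
  have "(\<lambda>n. flat_exp 1 (1 / real (Suc n)) t) \<longlonglongrightarrow> 1" if "0 < t" for t
  proof -
    have "(\<lambda>n. exp (- (1 / real (Suc n)) / t)) \<longlonglongrightarrow> exp (- 0 / t)"
      using that LIMSEQ_inverse_real_of_nat by (intro tendsto_intros) (auto simp: inverse_eq_divide)
    then show ?thesis using that by (simp add: flat_exp_def)
  qed
  then have "(\<lambda>n. box_bump p q (1 / real (Suc n)) x) \<longlonglongrightarrow> (\<Prod>i\<in>(Basis::'a set). 1 * 1)"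
    unfolding box_bump_def using True by (intro tendsto_intros) (auto simp: box_def inner_commute)
  then show ?thesis using True by simp
qed (simp add: box_bump_eq_0)

lemma box_bump_test_function:
  assumes "0 < c" "cbox p q \<subseteq> \<Omega>"
  shows "box_bump p q c \<in> test_functions \<Omega>"
proof -
  have "\<forall>x. x \<notin> cbox p q \<longrightarrow> box_bump p q c x = 0"
    using box_bump_eq_0 box_subset_cbox by blast
  then show ?thesis
    by (intro test_functionI[OF smooth_box_bump[OF assms(1)] compact_cbox assms(2)]) simp
qed

section \<open>Test functions and integration by parts\<close>

lemma test_functionE:
  assumes "\<phi> \<in> test_functions \<Omega>"
  obtains K where "compact K" "K \<subseteq> \<Omega>" "\<And>x. x \<notin> K \<Longrightarrow> \<phi> x = 0"
  using assms unfolding test_functions_def mem_Collect_eq by (elim conjE exE) simp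

lemma test_function_smooth: "\<phi> \<in> test_functions \<Omega> \<Longrightarrow> Ck_on k UNIV \<phi>"
  by (simp add: test_functions_def smooth_on_def)

lemma test_function_continuous: "\<phi> \<in> test_functions \<Omega> \<Longrightarrow> continuous_on UNIV \<phi>"
  using test_function_smooth[of \<phi> \<Omega> 0] by simp

lemma test_function_has_derivative:
  "\<phi> \<in> test_functions \<Omega> \<Longrightarrow> (\<phi> has_derivative frechet_derivative \<phi> (at x)) (at x)"
  using test_function_smooth[of \<phi> \<Omega> "Suc 0"]
  by (intro differentiable_on_UNIV_has_derivative) simp

lemma test_function_eq_0: "\<phi> \<in> test_functions \<Omega> \<Longrightarrow> x \<notin> \<Omega> \<Longrightarrow> \<phi> x = 0"
  by (metis test_functionE subsetD)

lemma test_function_partial: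
  assumes "\<phi> \<in> test_functions \<Omega>" "i \<in> Basis"
  shows "(\<lambda>x. frechet_derivative \<phi> (at x) i) \<in> test_functions \<Omega>"
proof -
  obtain K where K: "compact K" "K \<subseteq> \<Omega>" "\<And>x. x \<notin> K \<Longrightarrow> \<phi> x = 0"
    using assms(1) by (rule test_functionE) blast
  have "frechet_derivative \<phi> (at x) i = 0" if "x \<notin> K" for x
  proof -
    have "((\<lambda>_. 0) has_derivative (\<lambda>_. 0)) (at x)" by simp
    then have "(\<phi> has_derivative (\<lambda>_. 0)) (at x)"
      by (rule has_derivative_transform_within_open[of _ _ _ _ "- K"])
        (use that K in \<open>auto simp: compact_imp_closed open_Compl\<close>)
    then show ?thesis by (simp add: frechet_derivative_eqI)
  qed
  moreover have "smooth_on UNIV (\<lambda>x. frechet_derivative \<phi> (at x) i)"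
    unfolding smooth_on_def
  proof
    fix k
    show "Ck_on k UNIV (\<lambda>x. frechet_derivative \<phi> (at x) i)"
      using test_function_smooth[OF assms(1), of "Suc k"] assms(2) by simp
  qed
  ultimately show ?thesis using K(1,2) by (intro test_functionI)
qed

lemma test_function_lincomb:
  assumes "\<phi> \<in> test_functions \<Omega>" "\<psi> \<in> test_functions \<Omega>"
  shows "(\<lambda>x. c * \<phi> x + d * \<psi> x) \<in> test_functions \<Omega>"
proof -
  obtain K where K: "compact K" "K \<subseteq> \<Omega>" "\<And>x. x \<notin> K \<Longrightarrow> \<phi> x = 0"
    using assms(1) by (rule test_functionE) blast
  obtain L where L: "compact L" "L \<subseteq> \<Omega>" "\<And>x. x \<notin> L \<Longrightarrow> \<psi> x = 0"
    using assms(2) by (rule test_functionE) blast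
  from K L have "compact (K \<union> L)" "K \<union> L \<subseteq> \<Omega>" "\<And>x. x \<notin> K \<union> L \<Longrightarrow> c * \<phi> x + d * \<psi> x = 0"
    by auto
  moreover have "smooth_on UNIV (\<lambda>x. c * \<phi> x + d * \<psi> x)"
    unfolding smooth_on_def using assms by (intro allI Ck_on_lincomb test_function_smooth)
  ultimately show ?thesis by (intro test_functionI)
qed

lemma test_function_mult:
  assumes "\<phi> \<in> test_functions \<Omega>" "\<psi> \<in> test_functions \<Omega>"
  shows "(\<lambda>x. \<phi> x * \<psi> x) \<in> test_functions \<Omega>"
proof -
  obtain K where "compact K" "K \<subseteq> \<Omega>" "\<And>x. x \<notin> K \<Longrightarrow> \<phi> x = 0"
    using assms(1) by (rule test_functionE) blast
  then have "compact K" "K \<subseteq> \<Omega>" "\<And>x. x \<notin> K \<Longrightarrow> \<phi> x * \<psi> x = 0"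
    by auto
  moreover have "smooth_on UNIV (\<lambda>x. \<phi> x * \<psi> x)"
    unfolding smooth_on_def using assms by (intro allI Ck_on_mult test_function_smooth)
  ultimately show ?thesis by (intro test_functionI)
qed

lemma test_function_integrable:
  fixes \<phi> :: "'a::euclidean_space \<Rightarrow> real"
  assumes "\<phi> \<in> test_functions \<Omega>"
  shows "integrable lborel \<phi>"
proof -
  obtain K where K: "compact K" "K \<subseteq> \<Omega>" "\<And>x. x \<notin> K \<Longrightarrow> \<phi> x = 0"
    using assms by (rule test_functionE) blast
  then have "integrable lborel (\<lambda>x. indicator K x *\<^sub>R \<phi> x)"
    using test_function_continuous[OF assms]
    by (intro borel_integrable_compact) (auto intro: continuous_on_subset)
  also have "(\<lambda>x. indicator K x *\<^sub>R \<phi> x) = \<phi>"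
    using K(3) by (intro ext) (auto simp: indicator_def)
  finally show ?thesis .
qed

text \<open>A test function vanishes off \<Omega> and, being continuous, is Borel, so neither
  restriction nor completion of the measure changes its integral. Computations can thus use the
  translation invariance of \<open>lborel\<close>.\<close>

lemma test_function_integral_restrict:
  fixes \<phi> :: "'a::euclidean_space \<Rightarrow> real"
  assumes "\<phi> \<in> test_functions \<Omega>" "open \<Omega>"
  shows "integrable (lebesgue_on \<Omega>) \<phi>" "integral\<^sup>L (lebesgue_on \<Omega>) \<phi> = integral\<^sup>L lborel \<phi>"
proof -
  have eq: "(\<lambda>x. indicator \<Omega> x *\<^sub>R \<phi> x) = \<phi>"
    using test_function_eq_0[OF assms(1)] by (intro ext) (auto simp: indicator_def)
  have m: "\<phi> \<in> borel_measurable lborel"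
    using test_function_continuous[OF assms(1)] by (simp add: borel_measurable_continuous_onI)
  have \<Omega>: "\<Omega> \<inter> space lebesgue \<in> sets lebesgue" using assms(2) by simp
  show "integrable (lebesgue_on \<Omega>) \<phi>"
    unfolding integrable_restrict_space[OF \<Omega>] eq integrable_completion[OF m]
    by (rule test_function_integrable[OF assms(1)])
  show "integral\<^sup>L (lebesgue_on \<Omega>) \<phi> = integral\<^sup>L lborel \<phi>"
    unfolding integral_restrict_space[OF \<Omega>] eq integral_completion[OF m] ..
qed

text \<open>The integral of a difference quotient vanishes by translation invariance.\<close>

lemma integral_partial_test_function:
  fixes \<xi> :: "'a::euclidean_space \<Rightarrow> real"
  assumes \<xi>: "\<xi> \<in> test_functions \<Omega>" and i: "i \<in> Basis"
  shows "(\<integral>x. frechet_derivative \<xi> (at x) i \<partial>lborel) = 0"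
proof -
  let ?D = "\<lambda>x. frechet_derivative \<xi> (at x) i"
  obtain K where K: "compact K" "\<And>x. x \<notin> K \<Longrightarrow> \<xi> x = 0"
    using \<xi> by (rule test_functionE) blast
  obtain R where R: "\<And>x. x \<in> K \<Longrightarrow> norm x \<le> R"
    using compact_imp_bounded[OF K(1)] by (auto simp: bounded_iff)
  have contD: "continuous_on UNIV ?D"
    using test_function_partial[OF \<xi> i] by (rule test_function_continuous)
  have contX: "continuous_on UNIV \<xi>" using \<xi> by (rule test_function_continuous)
  \<comment> \<open>The quotients have step at most 1: they vanish outside radius
    \<open>R + 1\<close>, and inside it the mean value points stay within radius
    \<open>R + 2\<close>. Hence \<open>B\<close> on the smaller ball dominates them.\<close>
  obtain B where B: "\<And>x. x \<in> cball 0 (R + 2) \<Longrightarrow> \<bar>?D x\<bar> \<le> B"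
  proof -
    have "bounded (?D ` cball 0 (R + 2))"
      by (intro compact_imp_bounded compact_continuous_image continuous_on_subset[OF contD]) auto
    then obtain B where "\<forall>y\<in>?D ` cball 0 (R + 2). norm y \<le> B" unfolding bounded_iff by blast
    then show ?thesis by (intro that[of B]) auto
  qed
  define h where "h n = 1 / real (Suc n)" for n
  have h: "0 < h n" "h n \<le> 1" for n by (auto simp: h_def)
  define q where "q n x = (\<xi> (h n *\<^sub>R i + x) - \<xi> x) / h n" for n x
  have int: "integrable lborel \<xi>" by (rule test_function_integrable[OF \<xi>])
  have meas: "\<xi> \<in> borel_measurable borel"
    using contX by (simp add: borel_measurable_continuous_onI)
  have shift: "integrable lborel (\<lambda>x. \<xi> (v + x))" "(\<integral>x. \<xi> (v + x) \<partial>lborel) = (\<integral>x. \<xi> x \<partial>lborel)" for v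
  proof -
    have "integrable (distr lborel borel ((+) v)) \<xi>" using int by (simp add: lborel_distr_plus)
    then show "integrable lborel (\<lambda>x. \<xi> (v + x))"
      by (subst (asm) integrable_distr_eq) (auto simp: meas)
    have "(\<integral>x. \<xi> x \<partial>(distr lborel borel ((+) v))) = (\<integral>x. \<xi> (v + x) \<partial>lborel)"
      by (subst integral_distr) (auto simp: meas)
    then show "(\<integral>x. \<xi> (v + x) \<partial>lborel) = (\<integral>x. \<xi> x \<partial>lborel)" by (simp add: lborel_distr_plus)
  qed
  have q0: "(\<integral>x. q n x \<partial>lborel) = 0" for n
    unfolding q_def using shift int by simp
  have line: "((\<lambda>s. \<xi> (s *\<^sub>R i + x)) has_real_derivative ?D (s *\<^sub>R i + x)) (at s)" for s x
  proof -
    have "((\<lambda>s. s *\<^sub>R i + x) has_derivative (\<lambda>s. s *\<^sub>R i)) (at s)"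
      by (auto intro!: derivative_eq_intros)
    from has_derivative_compose[OF this test_function_has_derivative[OF \<xi>]]
    have "((\<lambda>s. \<xi> (s *\<^sub>R i + x)) has_derivative
        (\<lambda>t. frechet_derivative \<xi> (at (s *\<^sub>R i + x)) (t *\<^sub>R i))) (at s)" .
    moreover have "frechet_derivative \<xi> (at (s *\<^sub>R i + x)) (t *\<^sub>R i) = ?D (s *\<^sub>R i + x) * t" for t
      using has_derivative_bounded_linear[OF test_function_has_derivative[OF \<xi>]]
      by (simp add: linear_simps)
    ultimately show ?thesis by (simp add: has_field_derivative_def)
  qed
  have "(\<lambda>n. \<integral>x. q n x \<partial>lborel) \<longlonglongrightarrow> (\<integral>x. ?D x \<partial>lborel)"
  proof (rule integral_dominated_convergence[where w = "\<lambda>x. indicator (cball 0 (R + 1)) x *\<^sub>R B"])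
    show "?D \<in> borel_measurable lborel" using contD by (simp add: borel_measurable_continuous_onI)
    show "q n \<in> borel_measurable lborel" for n
      unfolding q_def[abs_def] using shift(1) int by (intro borel_measurable_integrable) simp
    show "integrable lborel (\<lambda>x::'a. indicator (cball 0 (R + 1)) x *\<^sub>R B)"
      by (intro borel_integrable_compact) auto
    show "AE x in lborel. (\<lambda>n. q n x) \<longlonglongrightarrow> ?D x"
    proof (rule AE_I2)
      fix x
      have "((\<lambda>t. (\<xi> (t *\<^sub>R i + x) - \<xi> x) / t) \<longlongrightarrow> ?D x) (at 0)"
        using line[of x 0] by (simp add: DERIV_def)
      moreover have "filterlim h (at 0) sequentially"
        using h LIMSEQ_inverse_real_of_nat unfolding filterlim_at h_def
        by (auto simp: inverse_eq_divide)
      ultimately show "(\<lambda>n. q n x) \<longlonglongrightarrow> ?D x"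
        unfolding q_def by (rule filterlim_compose)
    qed
    show "AE x in lborel. norm (q n x) \<le> indicator (cball 0 (R + 1)) x *\<^sub>R B" for n
    proof (rule AE_I2)
      fix x :: 'a
      show "norm (q n x) \<le> indicator (cball 0 (R + 1)) x *\<^sub>R B"
      proof (cases "x \<in> cball 0 (R + 1)")
        case True
        obtain s where s: "0 < s" "s < h n"
          "\<xi> (h n *\<^sub>R i + x) - \<xi> (0 *\<^sub>R i + x) = (h n - 0) * ?D (s *\<^sub>R i + x)"
          using MVT2[OF h(1)[of n], of "\<lambda>s. \<xi> (s *\<^sub>R i + x)" "\<lambda>s. ?D (s *\<^sub>R i + x)"] line by blast
        then have "q n x = ?D (s *\<^sub>R i + x)"
          using h(1)[of n] by (simp add: q_def)
        moreover have "norm (s *\<^sub>R i + x) \<le> norm (s *\<^sub>R i) + norm x" by (rule norm_triangle_ineq)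
        then have "s *\<^sub>R i + x \<in> cball 0 (R + 2)"
          using True s h(2)[of n] i by simp
        ultimately show ?thesis using B True by simp
      next
        case False
        then have x: "R + 1 < norm x" by simp
        have "norm x - norm (h n *\<^sub>R i) \<le> norm (h n *\<^sub>R i + x)"
          using norm_diff_ineq[of x "h n *\<^sub>R i"] by (simp add: add.commute)
        then have "R < norm (h n *\<^sub>R i + x)" "R < norm x"
          using x i h[of n] by auto
        then have "\<xi> (h n *\<^sub>R i + x) = 0" "\<xi> x = 0" using R K(2) by (meson not_le)+
        then show ?thesis using False by (simp add: q_def)
      qed
    qed
  qed
  then show ?thesis unfolding q0 by (simp add: LIMSEQ_const_iff)
qed

text \<open>The product of two test functions is a test function, so its partial derivative
  integrates to zero; the product rule then gives integration by parts.\<close>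

lemma test_function_has_weak_partial:
  assumes \<phi>: "\<phi> \<in> test_functions \<Omega>" and "open \<Omega>" and i: "i \<in> Basis"
  shows "has_weak_partial \<Omega> \<phi> i (\<lambda>x. frechet_derivative \<phi> (at x) i)"
  unfolding has_weak_partial_def L2_inner_def
proof
  fix \<psi> assume \<psi>: "\<psi> \<in> test_functions \<Omega>"
  let ?P = "\<lambda>\<phi> x. frechet_derivative \<phi> (at x) i"
  note prods = test_function_mult[OF \<phi> test_function_partial[OF \<psi> i]]
    test_function_mult[OF test_function_partial[OF \<phi> i] \<psi>]
  have "?P (\<lambda>x. \<phi> x * \<psi> x) = (\<lambda>x. \<phi> x * ?P \<psi> x + ?P \<phi> x * \<psi> x)"
    by (intro ext) (simp only: frechet_derivative_eqI[OF has_derivative_mult[OF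
          test_function_has_derivative[OF \<phi>] test_function_has_derivative[OF \<psi>]]])
  then have "0 = (\<integral>x. \<phi> x * ?P \<psi> x + ?P \<phi> x * \<psi> x \<partial>lborel)"
    using integral_partial_test_function[OF test_function_mult[OF \<phi> \<psi>] i] by simp
  also have "\<dots> = (\<integral>x. \<phi> x * ?P \<psi> x \<partial>lborel) + (\<integral>x. ?P \<phi> x * \<psi> x \<partial>lborel)"
    by (intro Bochner_Integration.integral_add prods[THEN test_function_integrable])
  finally show "(LINT x|lebesgue_on \<Omega>. \<phi> x * ?P \<psi> x) = - (LINT x|lebesgue_on \<Omega>. ?P \<phi> x * \<psi> x)"
    using prods[THEN test_function_integral_restrict(2), OF \<open>open \<Omega>\<close>] by simp
qed

section \<open>The space \<open>L\<^sup>2(\<Omega>)\<close>\<close>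

lemma L2_spaceD:
  assumes "u \<in> L2_space \<Omega>"
  shows "u \<in> borel_measurable (lebesgue_on \<Omega>)" "integrable (lebesgue_on \<Omega>) (\<lambda>x. (u x)\<^sup>2)"
  using assms by (auto simp: L2_space_def)

lemma L2_integrable_mult:
  assumes "u \<in> L2_space \<Omega>" "v \<in> L2_space \<Omega>"
  shows "integrable (lebesgue_on \<Omega>) (\<lambda>x. u x * v x)"
proof (rule Bochner_Integration.integrable_bound)
  show "integrable (lebesgue_on \<Omega>) (\<lambda>x. (u x)\<^sup>2 + (v x)\<^sup>2)"
    using assms by (intro Bochner_Integration.integrable_add L2_spaceD)
  show "(\<lambda>x. u x * v x) \<in> borel_measurable (lebesgue_on \<Omega>)"
    using assms by (intro borel_measurable_times L2_spaceD)
  have "\<bar>a * b\<bar> \<le> a\<^sup>2 + b\<^sup>2" for a b :: real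
  proof -
    have "2 * \<bar>a * b\<bar> \<le> a\<^sup>2 + b\<^sup>2"
      using sum_squares_bound[of "\<bar>a\<bar>" "\<bar>b\<bar>"] by (simp add: abs_mult)
    moreover have "0 \<le> a\<^sup>2 + b\<^sup>2" by simp
    ultimately show ?thesis by linarith
  qed
  then show "AE x in lebesgue_on \<Omega>. norm (u x * v x) \<le> norm ((u x)\<^sup>2 + (v x)\<^sup>2)"
    by simp
qed

text \<open>A common interface for the L2, H1, H10 and finite element spaces, through which the
  \<sigma>-average and the discrete derivative of a sequence stay in each of them.\<close>

definition lincomb_closed :: "('a \<Rightarrow> real) set \<Rightarrow> bool" where
  "lincomb_closed V \<longleftrightarrow> (\<forall>u\<in>V. \<forall>v\<in>V. \<forall>c d. (\<lambda>x. c * u x + d * v x) \<in> V)"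

lemma lincomb_closedD:
  "lincomb_closed V \<Longrightarrow> u \<in> V \<Longrightarrow> v \<in> V \<Longrightarrow> (\<lambda>x. c * u x + d * v x) \<in> V"
  by (simp add: lincomb_closed_def)

lemma lincomb_closed_increments:
  fixes u :: "nat \<Rightarrow> 'a \<Rightarrow> real"
  assumes V: "lincomb_closed V" and u: "\<And>j. j \<le> n \<Longrightarrow> u j \<in> V"
  shows "(\<lambda>x. \<Sum>j=1..n. g j * (u j x - u (j - 1) x)) \<in> V"
proof -
  have "m \<le> n \<Longrightarrow> (\<lambda>x. \<Sum>j=1..m. g j * (u j x - u (j - 1) x)) \<in> V" for m
  proof (induction m)
    case 0
    \<comment> \<open>The empty sum is the zero function, obtained as
      \<open>0 * u 0 x + 0 * u 0 x\<close>.\<close>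
    then show ?case using lincomb_closedD[OF V u u, of 0 0 0 0] by simp
  next
    case (Suc m)
    then have IH: "(\<lambda>x. \<Sum>j=1..m. g j * (u j x - u (j - 1) x)) \<in> V" by simp
    have "(\<lambda>x. g (Suc m) * u (Suc m) x + (- g (Suc m)) * u m x) \<in> V"
      using Suc.prems by (intro lincomb_closedD[OF V] u) auto
    from lincomb_closedD[OF V IH this, of 1 1] show ?case
      by (simp add: algebra_simps)
  qed
  then show ?thesis by simp
qed

lemma lincomb_closed_sigma_avg:
  assumes "lincomb_closed V" "u n \<in> V" "u (n - 1) \<in> V"
  shows "sigma_avg \<alpha> u n \<in> V"
  unfolding sigma_avg_def Let_def by (rule lincomb_closedD[OF assms])

lemma lincomb_closed_L2_1sigma:
  assumes "lincomb_closed V" "\<And>j. j \<le> n \<Longrightarrow> u j \<in> V"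
  shows "L2_1sigma \<alpha> T r N u n \<in> V"
  unfolding L2_1sigma_def by (rule lincomb_closed_increments[OF assms])

lemma lincomb_closed_L2_space: "lincomb_closed (L2_space \<Omega>)"
  unfolding lincomb_closed_def
proof (intro ballI allI)
  fix u v :: "'a \<Rightarrow> real" and c d :: real
  assume uv: "u \<in> L2_space \<Omega>" "v \<in> L2_space \<Omega>"
  have "integrable (lebesgue_on \<Omega>) (\<lambda>x. c\<^sup>2 * (u x)\<^sup>2 + 2 * c * d * (u x * v x) + d\<^sup>2 * (v x)\<^sup>2)"
    using uv by (intro Bochner_Integration.integrable_add integrable_mult_right L2_spaceD L2_integrable_mult)
  also have "(\<lambda>x. c\<^sup>2 * (u x)\<^sup>2 + 2 * c * d * (u x * v x) + d\<^sup>2 * (v x)\<^sup>2) = (\<lambda>x. (c * u x + d * v x)\<^sup>2)"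
    by (simp add: power2_eq_square algebra_simps)
  finally show "(\<lambda>x. c * u x + d * v x) \<in> L2_space \<Omega>"
    using uv by (auto simp: L2_space_def)
qed

lemma L2_inner_commute: "L2_inner \<Omega> u v = L2_inner \<Omega> v u"
  by (simp add: L2_inner_def mult.commute)

lemma L2_inner_lincomb_left:
  assumes "u \<in> L2_space \<Omega>" "v \<in> L2_space \<Omega>" "w \<in> L2_space \<Omega>"
  shows "L2_inner \<Omega> (\<lambda>x. c * u x + d * v x) w = c * L2_inner \<Omega> u w + d * L2_inner \<Omega> v w"
proof -
  have "L2_inner \<Omega> (\<lambda>x. c * u x + d * v x) w = (LINT x|lebesgue_on \<Omega>. c * (u x * w x) + d * (v x * w x))"
    unfolding L2_inner_def by (rule Bochner_Integration.integral_cong) (auto simp: algebra_simps)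
  also have "\<dots> = c * L2_inner \<Omega> u w + d * L2_inner \<Omega> v w"
    using assms by (simp add: L2_inner_def L2_integrable_mult)
  finally show ?thesis .
qed

lemma L2_inner_lincomb_right:
  assumes "u \<in> L2_space \<Omega>" "v \<in> L2_space \<Omega>" "w \<in> L2_space \<Omega>"
  shows "L2_inner \<Omega> w (\<lambda>x. c * u x + d * v x) = c * L2_inner \<Omega> w u + d * L2_inner \<Omega> w v"
  using L2_inner_lincomb_left[OF assms] by (simp add: L2_inner_commute)

lemma L2_inner_self_nonneg: "0 \<le> L2_inner \<Omega> u u"
  by (simp add: L2_inner_def)

lemma L2_norm_nonneg [simp]: "0 \<le> L2_norm \<Omega> u"
  by (simp add: L2_norm_def L2_inner_self_nonneg)

lemma L2_norm_squared: "(L2_norm \<Omega> u)\<^sup>2 = L2_inner \<Omega> u u"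
  by (simp add: L2_norm_def L2_inner_self_nonneg)

lemma L2_inner_cong_AE:
  assumes "AE x in lebesgue_on \<Omega>. u x = u' x" "AE x in lebesgue_on \<Omega>. v x = v' x"
    and "u \<in> L2_space \<Omega>" "u' \<in> L2_space \<Omega>" "v \<in> L2_space \<Omega>" "v' \<in> L2_space \<Omega>"
  shows "L2_inner \<Omega> u v = L2_inner \<Omega> u' v'"
  unfolding L2_inner_def
proof (rule integral_cong_AE)
  show "AE x in lebesgue_on \<Omega>. u x * v x = u' x * v' x"
    using assms(1,2) by eventually_elim simp
qed (use assms(3-) in \<open>auto intro!: borel_measurable_times dest!: L2_spaceD(1)\<close>)

lemma L2_Cauchy_Schwarz:
  assumes "u \<in> L2_space \<Omega>" "v \<in> L2_space \<Omega>"
  shows "L2_inner \<Omega> u v \<le> L2_norm \<Omega> u * L2_norm \<Omega> v"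
proof -
  let ?i = "L2_inner \<Omega>"
  have q: "0 \<le> ?i u u + 2 * t * ?i u v + t\<^sup>2 * ?i v v" for t
  proof -
    have w: "(\<lambda>x. 1 * u x + t * v x) \<in> L2_space \<Omega>"
      using assms by (intro lincomb_closedD[OF lincomb_closed_L2_space])
    have "0 \<le> ?i (\<lambda>x. 1 * u x + t * v x) (\<lambda>x. 1 * u x + t * v x)"
      by (rule L2_inner_self_nonneg)
    also have "\<dots> = ?i u u + 2 * t * ?i u v + t\<^sup>2 * ?i v v"
      by (simp only: L2_inner_lincomb_left[OF assms w] L2_inner_lincomb_right[OF assms assms(1)]
          L2_inner_lincomb_right[OF assms assms(2)] L2_inner_commute[of \<Omega> v u])
        (simp add: power2_eq_square algebra_simps)
    finally show ?thesis .
  qed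
  have "(?i u v)\<^sup>2 \<le> ?i u u * ?i v v"
  proof (cases "?i v v = 0")
    case True
    have "?i u v = 0"
    proof (rule ccontr)
      assume "?i u v \<noteq> 0"
      \<comment> \<open>For vanishing \<open>?i v v\<close> the polynomial in \<open>t\<close> is
        affine; this \<open>t\<close> gives it the value -1.\<close>
      then have "2 * (- (?i u u + 1) / (2 * ?i u v)) * ?i u v = - (?i u u + 1)" by simp
      then show False using q[of "- (?i u u + 1) / (2 * ?i u v)"] True by simp
    qed
    then show ?thesis using L2_inner_self_nonneg[of \<Omega>] by simp
  next
    case False
    then have p: "0 < ?i v v" using L2_inner_self_nonneg[of \<Omega> v] by simp
    \<comment> \<open>The chosen \<open>t\<close> is the minimiser of the quadratic.\<close>
    then have "?i u u + 2 * (- ?i u v / ?i v v) * ?i u v + (- ?i u v / ?i v v)\<^sup>2 * ?i v v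
        = ?i u u - (?i u v)\<^sup>2 / ?i v v"
      by (simp add: power2_eq_square field_simps)
    then have "(?i u v)\<^sup>2 / ?i v v \<le> ?i u u" using q[of "- ?i u v / ?i v v"] by simp
    then show ?thesis using p by (simp add: pos_divide_le_eq)
  qed
  then have "\<bar>?i u v\<bar> \<le> sqrt (?i u u * ?i v v)" by (metis real_sqrt_abs real_sqrt_le_iff)
  then show ?thesis by (simp add: L2_norm_def real_sqrt_mult)
qed

text \<open>The scalar Alikhanov inequality is applied to the values at each point and
  integrated.\<close>

lemma L2_inner_sigma_avg_lower:
  fixes u :: "nat \<Rightarrow> 'a::euclidean_space \<Rightarrow> real"
  assumes n: "1 \<le> n" and \<sigma>: "0 \<le> \<sigma>" "\<sigma> < 1 / 2"
    and g: "\<And>j. 1 \<le> j \<Longrightarrow> j \<le> n \<Longrightarrow> 0 < g j"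
      "\<And>j. 1 \<le> j \<Longrightarrow> j < n \<Longrightarrow> g j \<le> g (j + 1)"
      "2 \<le> n \<Longrightarrow> (1 - \<sigma>) * g (n - 1) \<le> (1 - 2 * \<sigma>) * g n"
    and u: "\<And>j. j \<le> n \<Longrightarrow> u j \<in> L2_space \<Omega>"
  shows "(\<Sum>j=1..n. g j * (L2_inner \<Omega> (u j) (u j) - L2_inner \<Omega> (u (j - 1)) (u (j - 1)))) / 2
    \<le> L2_inner \<Omega> (\<lambda>x. \<Sum>j=1..n. g j * (u j x - u (j - 1) x))
        (\<lambda>x. (1 - \<sigma>) * u n x + \<sigma> * u (n - 1) x)"
proof -
  have i: "integrable (lebesgue_on \<Omega>) (\<lambda>x. g j * ((u j x)\<^sup>2 - (u (j - 1) x)\<^sup>2))"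
    if "j \<in> {1..n}" for j
    using u that by (intro integrable_mult_right Bochner_Integration.integrable_diff L2_spaceD) auto
  have "(\<Sum>j=1..n. g j * (L2_inner \<Omega> (u j) (u j) - L2_inner \<Omega> (u (j - 1)) (u (j - 1)))) / 2
     = (LINT x|lebesgue_on \<Omega>. (\<Sum>j=1..n. g j * ((u j x)\<^sup>2 - (u (j - 1) x)\<^sup>2)) / 2)"
  proof -
    have "g j * (L2_inner \<Omega> (u j) (u j) - L2_inner \<Omega> (u (j - 1)) (u (j - 1)))
        = (LINT x|lebesgue_on \<Omega>. g j * ((u j x)\<^sup>2 - (u (j - 1) x)\<^sup>2))" if "j \<in> {1..n}" for j
    proof -
      have "u j \<in> L2_space \<Omega>" "u (j - 1) \<in> L2_space \<Omega>" using u that by auto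
      then show ?thesis by (simp add: L2_inner_def power2_eq_square[symmetric] L2_spaceD)
    qed
    then have "(\<Sum>j=1..n. g j * (L2_inner \<Omega> (u j) (u j) - L2_inner \<Omega> (u (j - 1)) (u (j - 1))))
        = (\<Sum>j=1..n. LINT x|lebesgue_on \<Omega>. g j * ((u j x)\<^sup>2 - (u (j - 1) x)\<^sup>2))"
      by (intro sum.cong refl)
    also have "\<dots> = (LINT x|lebesgue_on \<Omega>. (\<Sum>j=1..n. g j * ((u j x)\<^sup>2 - (u (j - 1) x)\<^sup>2)))"
      by (rule Bochner_Integration.integral_sum[symmetric, OF i])
    finally show ?thesis by simp
  qed
  also have "\<dots> \<le> L2_inner \<Omega> (\<lambda>x. \<Sum>j=1..n. g j * (u j x - u (j - 1) x))
        (\<lambda>x. (1 - \<sigma>) * u n x + \<sigma> * u (n - 1) x)"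
    unfolding L2_inner_def
  proof (rule integral_mono)
    show "integrable (lebesgue_on \<Omega>) (\<lambda>x. (\<Sum>j=1..n. g j * ((u j x)\<^sup>2 - (u (j - 1) x)\<^sup>2)) / 2)"
      by (intro integrable_divide Bochner_Integration.integrable_sum i)
    show "integrable (lebesgue_on \<Omega>) (\<lambda>x. (\<Sum>j=1..n. g j * (u j x - u (j - 1) x))
        * ((1 - \<sigma>) * u n x + \<sigma> * u (n - 1) x))"
      using u by (intro L2_integrable_mult lincomb_closed_increments
          lincomb_closedD[OF lincomb_closed_L2_space] lincomb_closed_L2_space) auto
    show "(\<Sum>j=1..n. g j * ((u j x)\<^sup>2 - (u (j - 1) x)\<^sup>2)) / 2
        \<le> (\<Sum>j=1..n. g j * (u j x - u (j - 1) x)) * ((1 - \<sigma>) * u n x + \<sigma> * u (n - 1) x)" for x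
      using sigma_average_times_increments[OF n \<sigma> g, of "\<lambda>j. u j x"] .
  qed
  finally show ?thesis .
qed

text \<open>Boxes are an intersection-stable generator of the Borel sets, and the sets over which
  \<open>h\<close> integrates to zero form a Dynkin system; complements use that the total integral
  vanishes. Then \<open>h\<close> and 0 have equal integrals over all measurable sets.\<close>

lemma AE_eq_0_if_box_integrals_0:
  fixes h :: "'a::euclidean_space \<Rightarrow> real"
  assumes h: "integrable lebesgue h" "integral\<^sup>L lebesgue h = 0"
    and box: "\<And>a b. (LINT x:box a b|lebesgue. h x) = 0"
  shows "AE x in lebesgue. h x = 0"
proof (rule density_unique_real[OF h(1) integrable_zero])
  have si: "set_integrable lebesgue A h" if "A \<in> sets lebesgue" for A
    using h(1) that unfolding set_integrable_def by (rule integrable_mult_indicator[rotated])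
  have borel: "(LINT x:A|lebesgue. h x) = 0" if "A \<in> sets borel" for A
  proof -
    have "Int_stable (range (\<lambda>(a, b). box a b :: 'a set))"
      by (auto simp: Int_stable_def box_Int_box)
    moreover have "range (\<lambda>(a, b). box a b :: 'a set) \<subseteq> Pow UNIV" by simp
    moreover have "A \<in> sigma_sets UNIV (range (\<lambda>(a, b). box a b))"
      using that by (simp add: borel_eq_box)
    ultimately show ?thesis
    proof (induction rule: sigma_sets_induct_disjoint)
      case (basic A)
      then show ?case using box by auto
    next
      case empty
      then show ?case by (simp add: set_lebesgue_integral_def)
    next
      case (compl A)
      then have A: "A \<in> sets borel" by (simp add: borel_eq_box)
      have "(LINT x:A \<union> (UNIV - A)|lebesgue. h x) = (LINT x:A|lebesgue. h x) + (LINT x:UNIV - A|lebesgue. h x)"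
        using A by (intro set_integral_Un si) auto
      then show ?case using compl h(2) by (simp add: set_lebesgue_integral_def)
    next
      case (union A)
      then have A: "A i \<in> sets borel" for i by (auto simp: borel_eq_box)
      have "(LINT x:(\<Union>i. A i)|lebesgue. h x) = (\<Sum>i. LINT x:A i|lebesgue. h x)"
        using union(1) A by (intro lebesgue_integral_countable_add si) (auto simp: disjoint_family_on_def)
      then show ?case using union by simp
    qed
  qed
  fix A :: "'a set" assume "A \<in> sets lebesgue"
  \<comment> \<open>A Lebesgue set is a Borel set up to a null set.\<close>
  then obtain S N N' where S: "A = S \<union> N" "N \<subseteq> N'" "N' \<in> null_sets lborel" "S \<in> sets lborel"
    by (rule sets_completionE)
  have "AE x in lebesgue. x \<notin> N'" using S(3) by (intro AE_completion AE_not_in)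
  then have "AE x in lebesgue. indicator A x *\<^sub>R h x = indicator S x *\<^sub>R h x"
    by eventually_elim (use S(1,2) in \<open>auto simp: indicator_def\<close>)
  then have "(LINT x:A|lebesgue. h x) = (LINT x:S|lebesgue. h x)"
    unfolding set_lebesgue_integral_def
    using si \<open>A \<in> sets lebesgue\<close> S(4)
    by (intro integral_cong_AE borel_measurable_integrable) (auto simp: set_integrable_def)
  then show "(LINT x:A|lebesgue. h x) = (LINT x:A|lebesgue. 0)" using borel S(4) by simp
qed

section \<open>Weak derivatives and the finite element space\<close>

lemma test_function_in_L2:
  assumes "\<phi> \<in> test_functions \<Omega>" "open \<Omega>"
  shows "\<phi> \<in> L2_space \<Omega>"
  using test_function_integral_restrict(1)[OF assms]
    test_function_integral_restrict(1)[OF test_function_mult[OF assms(1) assms(1)] assms(2)]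
  by (simp add: L2_space_def power2_eq_square borel_measurable_integrable)

text \<open>Letting the bumps tend to indicators shows that \<open>d\<close> integrates to zero over
  every box with closure in \<Omega>. This gives \<open>d = 0\<close> almost everywhere on each
  closed box in \<Omega>, and countably many of these cover the open set \<Omega>.\<close>

lemma fundamental_lemma:
  fixes d :: "'a::euclidean_space \<Rightarrow> real"
  assumes \<Omega>: "open \<Omega>" "bounded \<Omega>" and d: "d \<in> L2_space \<Omega>"
    and 0: "\<And>\<phi>. \<phi> \<in> test_functions \<Omega> \<Longrightarrow> L2_inner \<Omega> d \<phi> = 0"
  shows "AE x in lebesgue_on \<Omega>. d x = 0"
proof -
  have \<Omega>m: "\<Omega> \<inter> space lebesgue \<in> sets lebesgue" using \<Omega> by simp
  \<comment> \<open>A bounded open set has finite measure, so square integrability of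
    \<open>d\<close> implies integrability; \<open>\<bar>d x\<bar>\<close> will dominate the bump
    integrals.\<close>
  have "(\<lambda>_. 1) \<in> L2_space \<Omega>"
    using finite_measure.integrable_const[OF finite_measure_lebesgue_on[OF lmeasurable_open[OF \<Omega>(2,1)]]]
    by (simp add: L2_space_def)
  from L2_integrable_mult[OF d this] have d1: "integrable (lebesgue_on \<Omega>) d" by simp
  have box0: "(LINT x|lebesgue_on \<Omega>. d x * indicator (box a b) x) = 0" if ab: "cbox a b \<subseteq> \<Omega>" for a b
  proof -
    let ?c = "\<lambda>n. 1 / real (Suc n)"
    have \<phi>: "box_bump a b (?c n) \<in> test_functions \<Omega>" for n
      by (rule box_bump_test_function[OF _ ab]) simp
    have "(\<lambda>n. LINT x|lebesgue_on \<Omega>. d x * box_bump a b (?c n) x)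
        \<longlonglongrightarrow> (LINT x|lebesgue_on \<Omega>. d x * indicator (box a b) x)"
    proof (rule integral_dominated_convergence[where w = "\<lambda>x. \<bar>d x\<bar>"])
      show "(\<lambda>x. d x * indicator (box a b) x) \<in> borel_measurable (lebesgue_on \<Omega>)"
      proof (intro borel_measurable_times L2_spaceD(1)[OF d])
        have "(indicator (box a b) :: 'a \<Rightarrow> real) \<in> borel_measurable lebesgue"
          by (intro borel_measurable_indicator) auto
        then show "(indicator (box a b) :: 'a \<Rightarrow> real) \<in> borel_measurable (lebesgue_on \<Omega>)"
          by (rule measurable_restrict_space1)
      qed
      show "(\<lambda>x. d x * box_bump a b (?c n) x) \<in> borel_measurable (lebesgue_on \<Omega>)" for n
        by (intro borel_measurable_times L2_spaceD(1)[OF d] L2_spaceD(1)[OF test_function_in_L2[OF \<phi> \<Omega>(1)]])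
      show "integrable (lebesgue_on \<Omega>) (\<lambda>x. \<bar>d x\<bar>)" using d1 by simp
      show "AE x in lebesgue_on \<Omega>. (\<lambda>n. d x * box_bump a b (?c n) x) \<longlonglongrightarrow> d x * indicator (box a b) x"
        by (intro AE_I2 tendsto_mult tendsto_const box_bump_tendsto)
      have "\<bar>box_bump a b (?c n) x\<bar> \<le> 1" for n x
        using box_bump_bounds[of "?c n" a b x] by simp
      then have "\<bar>d x\<bar> * \<bar>box_bump a b (?c n) x\<bar> \<le> \<bar>d x\<bar> * 1" for n x
        by (intro mult_left_mono) auto
      then show "AE x in lebesgue_on \<Omega>. norm (d x * box_bump a b (?c n) x) \<le> \<bar>d x\<bar>" for n
        by (simp add: abs_mult)
    qed
    moreover have "(LINT x|lebesgue_on \<Omega>. d x * box_bump a b (?c n) x) = 0" for n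
      using 0[OF \<phi>] by (simp add: L2_inner_def)
    ultimately show ?thesis by (simp add: LIMSEQ_const_iff)
  qed
  have box0': "(LINT x|lebesgue. indicator (box a b) x * d x) = 0" if ab: "cbox a b \<subseteq> \<Omega>" for a b
  proof -
    have "(\<lambda>x. indicator \<Omega> x *\<^sub>R (d x * indicator (box a b) x)) = (\<lambda>x. indicator (box a b) x * d x)"
      using ab box_subset_cbox[of a b] by (intro ext) (auto simp: indicator_def)
    then show ?thesis using box0[OF ab] unfolding integral_restrict_space[OF \<Omega>m] by simp
  qed
  have ae: "AE x in lebesgue. x \<in> cbox p q \<longrightarrow> d x = 0" if pq: "cbox p q \<subseteq> \<Omega>" for p q
  proof -
    \<comment> \<open>After the cut-off, the integral of \<open>h\<close> over an arbitrary box is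
      that of \<open>d\<close> over the intersection of two boxes, again a box with closure in
      \<Omega>.\<close>
    define h where "h x = indicator (box p q) x * d x" for x
    have "AE x in lebesgue. h x = 0"
    proof (rule AE_eq_0_if_box_integrals_0)
      have "integrable lebesgue (\<lambda>x. indicator (box p q) x *\<^sub>R (indicator \<Omega> x *\<^sub>R d x))"
        using d1 unfolding integrable_restrict_space[OF \<Omega>m]
        by (intro integrable_mult_indicator[of "box p q"]) auto
      also have "(\<lambda>x. indicator (box p q) x *\<^sub>R (indicator \<Omega> x *\<^sub>R d x)) = h"
        using pq box_subset_cbox[of p q] by (intro ext) (auto simp: indicator_def h_def)
      finally show "integrable lebesgue h" .
      show "integral\<^sup>L lebesgue h = 0" using box0'[OF pq] by (simp add: h_def[abs_def])
      fix a b
      define a' b' where "a' = (\<Sum>i\<in>Basis. max (a \<bullet> i) (p \<bullet> i) *\<^sub>R i)"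
        and "b' = (\<Sum>i\<in>Basis. min (b \<bullet> i) (q \<bullet> i) *\<^sub>R i)"
      have "box a b \<inter> box p q = box a' b'" unfolding a'_def b'_def by (rule box_Int_box)
      then have "indicator (box a b) x *\<^sub>R h x = indicator (box a' b') x * d x" for x
        by (auto simp: h_def indicator_def)
      moreover have "cbox a' b' \<subseteq> cbox p q"
        by (auto simp: mem_box a'_def b'_def)
      with pq have "cbox a' b' \<subseteq> \<Omega>" by blast
      ultimately show "(LINT x:box a b|lebesgue. h x) = 0"
        using box0' by (simp add: set_lebesgue_integral_def)
    qed
    \<comment> \<open>\<open>h\<close> sees only the open box; the faces are negligible.\<close>
    moreover have "AE x in lebesgue. x \<notin> cbox p q - box p q"
      using negligible_frontier_interval[of p q] by (intro AE_not_in) (simp add: negligible_iff_null_sets)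
    ultimately show ?thesis by eventually_elim (auto simp: h_def indicator_def)
  qed
  obtain D where D: "countable D" "D \<subseteq> Pow \<Omega>" "\<And>X. X \<in> D \<Longrightarrow> \<exists>a b. X = cbox a b" "\<Union>D = \<Omega>"
    using open_countable_Union_open_cbox[OF \<Omega>(1)] by metis
  have "AE x in lebesgue. \<forall>X\<in>D. x \<in> X \<longrightarrow> d x = 0"
    unfolding AE_ball_countable[OF D(1)]
  proof
    fix X assume X: "X \<in> D"
    with D(3) obtain a b where "X = cbox a b" by blast
    with X D(2) ae show "AE x in lebesgue. x \<in> X \<longrightarrow> d x = 0" by blast
  qed
  then have "AE x in lebesgue. x \<in> \<Omega> \<longrightarrow> d x = 0"
    by eventually_elim (use D(4) in blast)
  then show ?thesis unfolding AE_restrict_space_iff[OF \<Omega>m] .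
qed

section \<open>Weak derivatives, the gradient form and the spaces built on them, over a bounded open
  set\<close>

context
  fixes \<Omega> :: "'a::euclidean_space set"
  assumes \<Omega>: "open \<Omega>" "bounded \<Omega>"
begin

lemma weak_partial_unique:
  assumes "g \<in> L2_space \<Omega>" "has_weak_partial \<Omega> u i g"
    and "h \<in> L2_space \<Omega>" "has_weak_partial \<Omega> u i h"
  shows "AE x in lebesgue_on \<Omega>. g x = h x"
proof -
  have "AE x in lebesgue_on \<Omega>. 1 * g x + (-1) * h x = 0"
  proof (rule fundamental_lemma[OF \<Omega>])
    show "(\<lambda>x. 1 * g x + (-1) * h x) \<in> L2_space \<Omega>"
      by (rule lincomb_closedD[OF lincomb_closed_L2_space assms(1,3)])
    fix \<phi> assume \<phi>: "\<phi> \<in> test_functions \<Omega>"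
    then have "- L2_inner \<Omega> g \<phi> = - L2_inner \<Omega> h \<phi>"
      using assms(2,4) unfolding has_weak_partial_def by metis
    then show "L2_inner \<Omega> (\<lambda>x. 1 * g x + (-1) * h x) \<phi> = 0"
      unfolding L2_inner_lincomb_left[OF assms(1,3) test_function_in_L2[OF \<phi> \<Omega>(1)]] by simp
  qed
  then show ?thesis by eventually_elim simp
qed

lemma has_weak_partial_lincomb:
  assumes "u \<in> L2_space \<Omega>" "g \<in> L2_space \<Omega>" "has_weak_partial \<Omega> u i g"
    and "v \<in> L2_space \<Omega>" "h \<in> L2_space \<Omega>" "has_weak_partial \<Omega> v i h" and i: "i \<in> Basis"
  shows "has_weak_partial \<Omega> (\<lambda>x. c * u x + d * v x) i (\<lambda>x. c * g x + d * h x)"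
  unfolding has_weak_partial_def
proof
  fix \<phi> assume \<phi>: "\<phi> \<in> test_functions \<Omega>"
  note L2 = test_function_in_L2[OF \<phi> \<Omega>(1)] test_function_in_L2[OF test_function_partial[OF \<phi> i] \<Omega>(1)]
  show "L2_inner \<Omega> (\<lambda>x. c * u x + d * v x) (\<lambda>x. frechet_derivative \<phi> (at x) i)
      = - L2_inner \<Omega> (\<lambda>x. c * g x + d * h x) \<phi>"
    using assms \<phi> L2 by (simp add: L2_inner_lincomb_left has_weak_partial_def)
qed

lemma weak_partial_spec:
  assumes "u \<in> sobolev_H1 \<Omega>" "i \<in> Basis"
  shows "weak_partial \<Omega> u i \<in> L2_space \<Omega>" "has_weak_partial \<Omega> u i (weak_partial \<Omega> u i)"
proof -
  have "\<exists>g. g \<in> L2_space \<Omega> \<and> has_weak_partial \<Omega> u i g"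
    using assms by (auto simp: sobolev_H1_def)
  from someI_ex[OF this] show "weak_partial \<Omega> u i \<in> L2_space \<Omega>"
    "has_weak_partial \<Omega> u i (weak_partial \<Omega> u i)"
    by (auto simp: weak_partial_def)
qed

lemma sobolev_H1_L2: "u \<in> sobolev_H1 \<Omega> \<Longrightarrow> u \<in> L2_space \<Omega>"
  by (simp add: sobolev_H1_def)

lemma lincomb_closed_sobolev_H1: "lincomb_closed (sobolev_H1 \<Omega>)"
  unfolding lincomb_closed_def
proof (intro ballI allI)
  fix u v :: "'a \<Rightarrow> real" and c d :: real
  assume uv: "u \<in> sobolev_H1 \<Omega>" "v \<in> sobolev_H1 \<Omega>"
  have "\<exists>g\<in>L2_space \<Omega>. has_weak_partial \<Omega> (\<lambda>x. c * u x + d * v x) i g" if i: "i \<in> Basis" for i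
  proof
    let ?g = "\<lambda>x. c * weak_partial \<Omega> u i x + d * weak_partial \<Omega> v i x"
    show "has_weak_partial \<Omega> (\<lambda>x. c * u x + d * v x) i ?g" "?g \<in> L2_space \<Omega>"
      by (intro has_weak_partial_lincomb lincomb_closedD[OF lincomb_closed_L2_space]
          weak_partial_spec uv[THEN sobolev_H1_L2] uv i)+
  qed
  moreover have "(\<lambda>x. c * u x + d * v x) \<in> L2_space \<Omega>"
    using uv by (intro lincomb_closedD[OF lincomb_closed_L2_space] sobolev_H1_L2)
  ultimately show "(\<lambda>x. c * u x + d * v x) \<in> sobolev_H1 \<Omega>"
    by (simp add: sobolev_H1_def)
qed

text \<open>\<open>weak_partial\<close> picks an arbitrary representative, so linearity is claimed
  only almost everywhere. Both sides are weak derivatives in L2 of the same function, hence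
  uniqueness applies.\<close>

lemma weak_partial_lincomb:
  assumes "u \<in> sobolev_H1 \<Omega>" "v \<in> sobolev_H1 \<Omega>" "i \<in> Basis"
  shows "AE x in lebesgue_on \<Omega>. weak_partial \<Omega> (\<lambda>x. c * u x + d * v x) i x
    = c * weak_partial \<Omega> u i x + d * weak_partial \<Omega> v i x"
proof (rule weak_partial_unique)
  note H1 = lincomb_closedD[OF lincomb_closed_sobolev_H1 assms(1,2)]
  show "weak_partial \<Omega> (\<lambda>x. c * u x + d * v x) i \<in> L2_space \<Omega>"
    "has_weak_partial \<Omega> (\<lambda>x. c * u x + d * v x) i (weak_partial \<Omega> (\<lambda>x. c * u x + d * v x) i)"
    by (rule weak_partial_spec[OF H1 assms(3)])+
  show "(\<lambda>x. c * weak_partial \<Omega> u i x + d * weak_partial \<Omega> v i x) \<in> L2_space \<Omega>"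
    using assms by (intro lincomb_closedD[OF lincomb_closed_L2_space] weak_partial_spec)
  show "has_weak_partial \<Omega> (\<lambda>x. c * u x + d * v x) i
      (\<lambda>x. c * weak_partial \<Omega> u i x + d * weak_partial \<Omega> v i x)"
    by (intro has_weak_partial_lincomb weak_partial_spec assms(1,2)[THEN sobolev_H1_L2] assms)
qed

lemma weak_partial_increments:
  fixes u :: "nat \<Rightarrow> 'a \<Rightarrow> real"
  assumes u: "\<And>j. j \<le> n \<Longrightarrow> u j \<in> sobolev_H1 \<Omega>" and i: "i \<in> Basis"
  shows "AE x in lebesgue_on \<Omega>. weak_partial \<Omega> (\<lambda>x. \<Sum>j=1..n. g j * (u j x - u (j - 1) x)) i x
    = (\<Sum>j=1..n. g j * (weak_partial \<Omega> (u j) i x - weak_partial \<Omega> (u (j - 1)) i x))"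
proof -
  let ?D = "\<lambda>u m x. \<Sum>j=1..m. g j * (u j x - u (j - 1) x)"
  have "m \<le> n \<Longrightarrow> AE x in lebesgue_on \<Omega>. weak_partial \<Omega> (?D u m) i x
    = ?D (\<lambda>j. weak_partial \<Omega> (u j) i) m x" for m
  proof (induction m)
    case 0
    \<comment> \<open>Even for the zero function the chosen weak derivative vanishes only almost
      everywhere; this is linearity with zero coefficients.\<close>
    have "AE x in lebesgue_on \<Omega>. weak_partial \<Omega> (\<lambda>x. 0 * u 0 x + 0 * u 0 x) i x
        = 0 * weak_partial \<Omega> (u 0) i x + 0 * weak_partial \<Omega> (u 0) i x"
      by (intro weak_partial_lincomb u i) simp_all
    then show ?case by simp
  next
    case (Suc m)
    define w where "w x = g (Suc m) * u (Suc m) x + (- g (Suc m)) * u m x" for x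
    have IH: "AE x in lebesgue_on \<Omega>. weak_partial \<Omega> (?D u m) i x
        = ?D (\<lambda>j. weak_partial \<Omega> (u j) i) m x"
      using Suc by simp
    have H1: "?D u m \<in> sobolev_H1 \<Omega>" "w \<in> sobolev_H1 \<Omega>"
      using u Suc.prems unfolding w_def
      by (intro lincomb_closed_increments lincomb_closedD[OF lincomb_closed_sobolev_H1]
          lincomb_closed_sobolev_H1; simp)+
    have w: "AE x in lebesgue_on \<Omega>. weak_partial \<Omega> w i x
        = g (Suc m) * weak_partial \<Omega> (u (Suc m)) i x + (- g (Suc m)) * weak_partial \<Omega> (u m) i x"
      using u Suc.prems i unfolding w_def by (intro weak_partial_lincomb) simp_all
    have "AE x in lebesgue_on \<Omega>. weak_partial \<Omega> (\<lambda>x. 1 * ?D u m x + 1 * w x) i x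
        = 1 * weak_partial \<Omega> (?D u m) i x + 1 * weak_partial \<Omega> w i x"
      by (rule weak_partial_lincomb[OF H1 i])
    moreover have "(\<lambda>x. 1 * ?D u m x + 1 * w x) = ?D u (Suc m)"
      by (simp add: w_def algebra_simps)
    ultimately have "AE x in lebesgue_on \<Omega>. weak_partial \<Omega> (?D u (Suc m)) i x
        = weak_partial \<Omega> (?D u m) i x + weak_partial \<Omega> w i x" by simp
    with IH w show ?case by eventually_elim (simp add: algebra_simps)
  qed
  then show ?thesis by simp
qed

lemma grad_inner_self_nonneg: "0 \<le> grad_inner \<Omega> u u"
  by (simp add: grad_inner_def sum_nonneg L2_inner_self_nonneg)

lemma grad_norm_squared: "(grad_norm \<Omega> u)\<^sup>2 = grad_inner \<Omega> u u"
  by (simp add: grad_norm_def grad_inner_self_nonneg)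

lemma grad_inner_commute: "grad_inner \<Omega> u v = grad_inner \<Omega> v u"
  by (simp add: grad_inner_def L2_inner_commute)

text \<open>In each coordinate direction the chosen weak derivatives are replaced, up to null sets,
  by the corresponding combinations of those of the \<open>u j\<close>; the L2 inequality is then
  summed over directions.\<close>

lemma grad_inner_sigma_avg_lower:
  fixes u :: "nat \<Rightarrow> 'a \<Rightarrow> real"
  assumes n: "1 \<le> n" and \<sigma>: "0 \<le> \<sigma>" "\<sigma> < 1 / 2"
    and g: "\<And>j. 1 \<le> j \<Longrightarrow> j \<le> n \<Longrightarrow> 0 < g j"
      "\<And>j. 1 \<le> j \<Longrightarrow> j < n \<Longrightarrow> g j \<le> g (j + 1)"
      "2 \<le> n \<Longrightarrow> (1 - \<sigma>) * g (n - 1) \<le> (1 - 2 * \<sigma>) * g n"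
    and u: "\<And>j. j \<le> n \<Longrightarrow> u j \<in> sobolev_H1 \<Omega>"
  shows "(\<Sum>j=1..n. g j * (grad_inner \<Omega> (u j) (u j) - grad_inner \<Omega> (u (j - 1)) (u (j - 1)))) / 2
    \<le> grad_inner \<Omega> (\<lambda>x. \<Sum>j=1..n. g j * (u j x - u (j - 1) x))
        (\<lambda>x. (1 - \<sigma>) * u n x + \<sigma> * u (n - 1) x)"
proof -
  let ?W = "\<lambda>i j. weak_partial \<Omega> (u j) i"
  let ?E = "\<lambda>i j. L2_inner \<Omega> (?W i j) (?W i j)"
  let ?R = "\<lambda>i. L2_inner \<Omega> (\<lambda>x. \<Sum>j=1..n. g j * (?W i j x - ?W i (j - 1) x))
        (\<lambda>x. (1 - \<sigma>) * ?W i n x + \<sigma> * ?W i (n - 1) x)"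
  have W: "?W i j \<in> L2_space \<Omega>" if "i \<in> Basis" "j \<le> n" for i j
    using that by (intro weak_partial_spec u)
  have R: "L2_inner \<Omega> (weak_partial \<Omega> (\<lambda>x. \<Sum>j=1..n. g j * (u j x - u (j - 1) x)) i)
      (weak_partial \<Omega> (\<lambda>x. (1 - \<sigma>) * u n x + \<sigma> * u (n - 1) x) i) = ?R i" if i: "i \<in> Basis" for i
  proof (rule L2_inner_cong_AE)
    show "AE x in lebesgue_on \<Omega>. weak_partial \<Omega> (\<lambda>x. (1 - \<sigma>) * u n x + \<sigma> * u (n - 1) x) i x
        = (1 - \<sigma>) * ?W i n x + \<sigma> * ?W i (n - 1) x"
      by (intro weak_partial_lincomb u i) simp_all
    show "AE x in lebesgue_on \<Omega>. weak_partial \<Omega> (\<lambda>x. \<Sum>j=1..n. g j * (u j x - u (j - 1) x)) i x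
        = (\<Sum>j=1..n. g j * (?W i j x - ?W i (j - 1) x))"
      by (rule weak_partial_increments[OF u i])
    show "weak_partial \<Omega> (\<lambda>x. \<Sum>j=1..n. g j * (u j x - u (j - 1) x)) i \<in> L2_space \<Omega>"
      "weak_partial \<Omega> (\<lambda>x. (1 - \<sigma>) * u n x + \<sigma> * u (n - 1) x) i \<in> L2_space \<Omega>"
      by (intro weak_partial_spec i lincomb_closed_increments lincomb_closed_sobolev_H1 u
          lincomb_closedD[OF lincomb_closed_sobolev_H1]; simp)+
    show "(\<lambda>x. \<Sum>j=1..n. g j * (?W i j x - ?W i (j - 1) x)) \<in> L2_space \<Omega>"
      "(\<lambda>x. (1 - \<sigma>) * ?W i n x + \<sigma> * ?W i (n - 1) x) \<in> L2_space \<Omega>"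
      by (intro lincomb_closed_increments lincomb_closed_L2_space W i
          lincomb_closedD[OF lincomb_closed_L2_space]; simp)+
  qed
  have "(\<Sum>j=1..n. g j * (grad_inner \<Omega> (u j) (u j) - grad_inner \<Omega> (u (j - 1)) (u (j - 1)))) / 2
      = (\<Sum>j=1..n. \<Sum>i\<in>Basis. g j * (?E i j - ?E i (j - 1))) / 2"
    by (simp add: grad_inner_def sum_subtractf[symmetric] sum_distrib_left)
  also have "\<dots> = (\<Sum>i\<in>Basis. (\<Sum>j=1..n. g j * (?E i j - ?E i (j - 1))) / 2)"
    by (subst sum.swap) (simp add: sum_divide_distrib)
  also have "\<dots> \<le> (\<Sum>i\<in>Basis. ?R i)"
    by (intro sum_mono L2_inner_sigma_avg_lower[OF n \<sigma> g] W)
  also have "\<dots> = grad_inner \<Omega> (\<lambda>x. \<Sum>j=1..n. g j * (u j x - u (j - 1) x))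
        (\<lambda>x. (1 - \<sigma>) * u n x + \<sigma> * u (n - 1) x)"
    using R by (simp add: grad_inner_def)
  finally show ?thesis .
qed

text \<open>The pointwise inequality
  \<open>(p + q)\<^sup>2 \<le> 2 * p\<^sup>2 + 2 * q\<^sup>2\<close> is integrated. In squared form
  it adds up over the function and its partial derivatives, which yields the estimate of the H1 norm
  below.\<close>

lemma L2_norm_lincomb_squared_le:
  assumes "u \<in> L2_space \<Omega>" "v \<in> L2_space \<Omega>"
  shows "L2_inner \<Omega> (\<lambda>x. c * u x + d * v x) (\<lambda>x. c * u x + d * v x)
    \<le> 2 * c\<^sup>2 * L2_inner \<Omega> u u + 2 * d\<^sup>2 * L2_inner \<Omega> v v"
proof -
  have "L2_inner \<Omega> (\<lambda>x. c * u x + d * v x) (\<lambda>x. c * u x + d * v x)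
      \<le> (LINT x|lebesgue_on \<Omega>. 2 * c\<^sup>2 * (u x * u x) + 2 * d\<^sup>2 * (v x * v x))"
    unfolding L2_inner_def
  proof (rule integral_mono)
    show "integrable (lebesgue_on \<Omega>) (\<lambda>x. (c * u x + d * v x) * (c * u x + d * v x))"
      using assms by (intro L2_integrable_mult lincomb_closedD[OF lincomb_closed_L2_space])
    show "integrable (lebesgue_on \<Omega>) (\<lambda>x. 2 * c\<^sup>2 * (u x * u x) + 2 * d\<^sup>2 * (v x * v x))"
      using assms by (intro Bochner_Integration.integrable_add integrable_mult_right L2_integrable_mult)
    fix x
    have "0 \<le> (c * u x - d * v x)\<^sup>2" by simp
    then show "(c * u x + d * v x) * (c * u x + d * v x) \<le> 2 * c\<^sup>2 * (u x * u x) + 2 * d\<^sup>2 * (v x * v x)"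
      by (simp add: power2_eq_square algebra_simps)
  qed
  also have "\<dots> = 2 * c\<^sup>2 * L2_inner \<Omega> u u + 2 * d\<^sup>2 * L2_inner \<Omega> v v"
    using assms by (simp add: L2_inner_def L2_integrable_mult)
  finally show ?thesis .
qed

lemma H1_norm_squared: "(H1_norm \<Omega> u)\<^sup>2 = L2_inner \<Omega> u u + grad_inner \<Omega> u u"
  by (simp add: H1_norm_def L2_norm_squared grad_norm_squared L2_inner_self_nonneg grad_inner_self_nonneg)

lemma H1_norm_nonneg: "0 \<le> H1_norm \<Omega> u"
  by (simp add: H1_norm_def)

lemma H1_norm_lincomb_squared_le:
  assumes "u \<in> sobolev_H1 \<Omega>" "v \<in> sobolev_H1 \<Omega>"
  shows "(H1_norm \<Omega> (\<lambda>x. c * u x + d * v x))\<^sup>2 \<le> 2 * c\<^sup>2 * (H1_norm \<Omega> u)\<^sup>2 + 2 * d\<^sup>2 * (H1_norm \<Omega> v)\<^sup>2"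
proof -
  let ?w = "\<lambda>x. c * u x + d * v x" and ?W = "weak_partial \<Omega>"
  have "L2_inner \<Omega> (?W ?w i) (?W ?w i) \<le> 2 * c\<^sup>2 * L2_inner \<Omega> (?W u i) (?W u i)
      + 2 * d\<^sup>2 * L2_inner \<Omega> (?W v i) (?W v i)" if i: "i \<in> Basis" for i
  proof -
    note H1 = lincomb_closedD[OF lincomb_closed_sobolev_H1 assms]
    have W: "?W ?w i \<in> L2_space \<Omega>" "?W u i \<in> L2_space \<Omega>" "?W v i \<in> L2_space \<Omega>"
      using assms H1 i by (auto intro: weak_partial_spec)
    note AE = weak_partial_lincomb[OF assms i, of c d]
    have "L2_inner \<Omega> (?W ?w i) (?W ?w i)
        = L2_inner \<Omega> (\<lambda>x. c * ?W u i x + d * ?W v i x) (\<lambda>x. c * ?W u i x + d * ?W v i x)"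
      using W by (intro L2_inner_cong_AE AE lincomb_closedD[OF lincomb_closed_L2_space])
    then show ?thesis using L2_norm_lincomb_squared_le[OF W(2,3)] by simp
  qed
  then have "grad_inner \<Omega> ?w ?w \<le> 2 * c\<^sup>2 * grad_inner \<Omega> u u + 2 * d\<^sup>2 * grad_inner \<Omega> v v"
    unfolding grad_inner_def sum_distrib_left sum.distrib[symmetric] by (rule sum_mono)
  with L2_norm_lincomb_squared_le[OF assms[THEN sobolev_H1_L2], of c d] show ?thesis
    by (simp add: H1_norm_squared algebra_simps)
qed

lemma test_function_in_H1: "\<phi> \<in> test_functions \<Omega> \<Longrightarrow> \<phi> \<in> sobolev_H1 \<Omega>"
  unfolding sobolev_H1_def
  using test_function_in_L2[OF _ \<Omega>(1)] test_function_partial test_function_has_weak_partial[OF _ \<Omega>(1)]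
  by blast

text \<open>The same combination of the two approximating sequences works: its error is the
  combination of the two errors, and these lie in H1 because test functions do.\<close>

lemma lincomb_closed_sobolev_H10: "lincomb_closed (sobolev_H10 \<Omega>)"
  unfolding lincomb_closed_def
proof (intro ballI allI)
  fix u v :: "'a \<Rightarrow> real" and c d :: real
  assume u: "u \<in> sobolev_H10 \<Omega>" and v: "v \<in> sobolev_H10 \<Omega>"
  obtain \<phi> where \<phi>: "\<And>k::nat. \<phi> k \<in> test_functions \<Omega>" "(\<lambda>k. H1_norm \<Omega> (\<lambda>x. \<phi> k x - u x)) \<longlonglongrightarrow> 0"
    using u unfolding sobolev_H10_def by blast
  obtain \<psi> where \<psi>: "\<And>k::nat. \<psi> k \<in> test_functions \<Omega>" "(\<lambda>k. H1_norm \<Omega> (\<lambda>x. \<psi> k x - v x)) \<longlonglongrightarrow> 0"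
    using v unfolding sobolev_H10_def by blast
  have H1: "u \<in> sobolev_H1 \<Omega>" "v \<in> sobolev_H1 \<Omega>" using u v by (auto simp: sobolev_H10_def)
  define e where "e k x = 1 * \<phi> k x + (-1) * u x" for k x
  define e' where "e' k x = 1 * \<psi> k x + (-1) * v x" for k x
  have eH1: "e k \<in> sobolev_H1 \<Omega>" "e' k \<in> sobolev_H1 \<Omega>" for k
    unfolding e_def e'_def
    by (intro lincomb_closedD[OF lincomb_closed_sobolev_H1] H1 test_function_in_H1 \<phi> \<psi>)+
  have lim: "(\<lambda>k. H1_norm \<Omega> (e k)) \<longlonglongrightarrow> 0" "(\<lambda>k. H1_norm \<Omega> (e' k)) \<longlonglongrightarrow> 0"
    using \<phi>(2) \<psi>(2) by (simp_all add: e_def[abs_def] e'_def[abs_def])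
  let ?\<theta> = "\<lambda>k x. c * \<phi> k x + d * \<psi> k x"
  have "(\<lambda>k. (H1_norm \<Omega> (\<lambda>x. ?\<theta> k x - (c * u x + d * v x)))\<^sup>2) \<longlonglongrightarrow> 0"
  proof (rule tendsto_sandwich[OF _ _ tendsto_const])
    show "\<forall>\<^sub>F k in sequentially. (H1_norm \<Omega> (\<lambda>x. ?\<theta> k x - (c * u x + d * v x)))\<^sup>2
        \<le> 2 * c\<^sup>2 * (H1_norm \<Omega> (e k))\<^sup>2 + 2 * d\<^sup>2 * (H1_norm \<Omega> (e' k))\<^sup>2"
    proof (rule always_eventually, rule allI)
      fix k
      have "(\<lambda>x. ?\<theta> k x - (c * u x + d * v x)) = (\<lambda>x. c * e k x + d * e' k x)"
        by (simp add: e_def e'_def algebra_simps)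
      then show "(H1_norm \<Omega> (\<lambda>x. ?\<theta> k x - (c * u x + d * v x)))\<^sup>2
        \<le> 2 * c\<^sup>2 * (H1_norm \<Omega> (e k))\<^sup>2 + 2 * d\<^sup>2 * (H1_norm \<Omega> (e' k))\<^sup>2"
        using H1_norm_lincomb_squared_le[OF eH1] by simp
    qed
    have "(\<lambda>k. 2 * c\<^sup>2 * (H1_norm \<Omega> (e k))\<^sup>2 + 2 * d\<^sup>2 * (H1_norm \<Omega> (e' k))\<^sup>2)
        \<longlonglongrightarrow> 2 * c\<^sup>2 * 0\<^sup>2 + 2 * d\<^sup>2 * 0\<^sup>2"
      by (intro tendsto_intros lim)
    then show "(\<lambda>k. 2 * c\<^sup>2 * (H1_norm \<Omega> (e k))\<^sup>2 + 2 * d\<^sup>2 * (H1_norm \<Omega> (e' k))\<^sup>2) \<longlonglongrightarrow> 0"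
      by simp
  qed simp
  then have "(\<lambda>k. sqrt ((H1_norm \<Omega> (\<lambda>x. ?\<theta> k x - (c * u x + d * v x)))\<^sup>2)) \<longlonglongrightarrow> sqrt 0"
    by (rule tendsto_real_sqrt)
  then have "(\<lambda>k. H1_norm \<Omega> (\<lambda>x. ?\<theta> k x - (c * u x + d * v x))) \<longlonglongrightarrow> 0"
    by (simp add: H1_norm_nonneg)
  moreover have "?\<theta> k \<in> test_functions \<Omega>" for k by (rule test_function_lincomb[OF \<phi>(1) \<psi>(1)])
  ultimately show "(\<lambda>x. c * u x + d * v x) \<in> sobolev_H10 \<Omega>"
    using lincomb_closedD[OF lincomb_closed_sobolev_H1 H1] unfolding sobolev_H10_def mem_Collect_eq
    by (intro conjI exI[of _ ?\<theta>]) auto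
qed

lemma lincomb_closed_fem_space: "lincomb_closed (fem_space \<Omega> Th)"
  unfolding lincomb_closed_def
proof (intro ballI allI)
  fix u v :: "'a \<Rightarrow> real" and c d :: real
  assume u: "u \<in> fem_space \<Omega> Th" and v: "v \<in> fem_space \<Omega> Th"
  let ?w = "\<lambda>x. c * u x + d * v x"
  have "?w \<in> sobolev_H10 \<Omega>"
    using u v by (intro lincomb_closedD[OF lincomb_closed_sobolev_H10]) (auto simp: fem_space_def)
  moreover have "continuous_on UNIV ?w"
    using u v by (auto simp: fem_space_def intro!: continuous_intros)
  moreover have "\<exists>b e. \<forall>x\<in>K. ?w x = b \<bullet> x + e" if "K \<in> Th" for K
  proof -
    have "\<exists>b e. \<forall>x\<in>K. u x = b \<bullet> x + e" "\<exists>b e. \<forall>x\<in>K. v x = b \<bullet> x + e"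
      using u v that by (simp_all add: fem_space_def)
    then obtain b1 e1 b2 e2
      where 1: "\<forall>x\<in>K. u x = b1 \<bullet> x + e1" and 2: "\<forall>x\<in>K. v x = b2 \<bullet> x + e2"
      by (elim exE)
    have "\<forall>x\<in>K. ?w x = (c *\<^sub>R b1 + d *\<^sub>R b2) \<bullet> x + (c * e1 + d * e2)"
      using 1 2 by (simp add: inner_add_left algebra_simps)
    then show ?thesis by (intro exI)
  qed
  moreover have "\<forall>x. x \<notin> \<Union>Th \<longrightarrow> ?w x = 0"
    using u v by (auto simp: fem_space_def)
  ultimately show "?w \<in> fem_space \<Omega> Th"
    by (simp add: fem_space_def)
qed

lemma fem_space_H1: "u \<in> fem_space \<Omega> Th \<Longrightarrow> u \<in> sobolev_H1 \<Omega>"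
  by (simp add: fem_space_def sobolev_H10_def)

text \<open>The inner product of the average \<open>?s\<close> with itself is expanded in one slot
  only; Cauchy-Schwarz bounds it by \<open>M * L2_norm \<Omega> ?s\<close>, and one factor
  cancels.\<close>

lemma sigma_avg_norm_le:
  fixes u :: "nat \<Rightarrow> 'a \<Rightarrow> real"
  assumes "0 \<le> \<alpha>" "\<alpha> \<le> 1" and u: "u n \<in> L2_space \<Omega>" "u (n - 1) \<in> L2_space \<Omega>"
    and M: "L2_norm \<Omega> (u n) \<le> M" "L2_norm \<Omega> (u (n - 1)) \<le> M"
  shows "L2_norm \<Omega> (sigma_avg \<alpha> u n) \<le> M"
proof -
  let ?s = "sigma_avg \<alpha> u n"
  have s: "?s \<in> L2_space \<Omega>" using u by (intro lincomb_closed_sigma_avg lincomb_closed_L2_space)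
  have "(L2_norm \<Omega> ?s)\<^sup>2 = (1 - \<alpha> / 2) * L2_inner \<Omega> (u n) ?s + \<alpha> / 2 * L2_inner \<Omega> (u (n - 1)) ?s"
    using L2_inner_lincomb_left[OF u s, of "1 - \<alpha> / 2" "\<alpha> / 2"]
    by (simp add: L2_norm_squared sigma_avg_def Let_def)
  also have "\<dots> \<le> (1 - \<alpha> / 2) * (M * L2_norm \<Omega> ?s) + \<alpha> / 2 * (M * L2_norm \<Omega> ?s)"
  proof -
    have "L2_inner \<Omega> (u m) ?s \<le> M * L2_norm \<Omega> ?s" if "u m \<in> L2_space \<Omega>" "L2_norm \<Omega> (u m) \<le> M" for m
      using L2_Cauchy_Schwarz[OF that(1) s] mult_right_mono[OF that(2), of "L2_norm \<Omega> ?s"] by simp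
    then show ?thesis using assms by (intro add_mono mult_left_mono) auto
  qed
  also have "\<dots> = M * L2_norm \<Omega> ?s" by (simp add: algebra_simps)
  finally have "L2_norm \<Omega> ?s * L2_norm \<Omega> ?s \<le> M * L2_norm \<Omega> ?s" by (simp add: power2_eq_square)
  moreover have "0 \<le> M" using M(1) L2_norm_nonneg[of \<Omega> "u n"] by linarith
  ultimately show ?thesis using L2_norm_nonneg[of \<Omega> ?s]
    by (cases "L2_norm \<Omega> ?s = 0") (auto simp: mult_le_cancel_right)
qed

end

section \<open>Stability of the scheme\<close>

lemma coeff_g_pos:
  assumes \<alpha>: "0 < \<alpha>" "\<alpha> < 1" and mesh: "0 < T" "1 \<le> r" "1 \<le> N" "1 \<le> n" "n \<le> N"
    and j: "1 \<le> j" "j \<le> n"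
  shows "0 < coeff_g \<alpha> T r N n j"
proof -
  have "coeff_g \<alpha> T r N n 1 \<le> coeff_g \<alpha> T r N n j"
    using j
  proof (induction j rule: dec_induct)
    case (step j)
    then show ?case using coeff_g_mono[OF \<alpha> mesh(1-4), of j] by simp
  qed simp
  moreover have "0 < T powr (-\<alpha>) / Gamma (1 - \<alpha>)"
    using \<alpha> mesh by (simp add: Gamma_real_pos)
  ultimately show ?thesis using coeff_g_first_ge[OF \<alpha> mesh] by linarith
qed

text \<open>Tested with the \<sigma>-average, the diffusion term is nonnegative and drops out.
  Tested with the discrete derivative, the scheme yields its full squared norm, which absorbs the
  load, and the lower bound \<open>m1\<close> frees the gradient term from the nonlinear
  coefficient.\<close>

lemma fully_discrete_energy_estimates:
  fixes \<Omega> :: "'a::euclidean_space set"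
  assumes \<Omega>: "open \<Omega>" "bounded \<Omega>"
    and \<alpha>: "0 < \<alpha>" "\<alpha> < 1" and mesh: "0 < T" "1 \<le> r" "1 \<le> N" "1 \<le> n" "n \<le> N"
    and m1: "0 < m1" "\<And>x. m1 \<le> a x"
    and f: "f (node_sigma \<alpha> T r N n) \<in> L2_space \<Omega>" "L2_norm \<Omega> (f (node_sigma \<alpha> T r N n)) \<le> F"
    and U: "fully_discrete_solution \<Omega> a f \<alpha> T r Th N U"
  shows "(\<Sum>j=1..n. coeff_g \<alpha> T r N n j * ((L2_norm \<Omega> (U j))\<^sup>2 - (L2_norm \<Omega> (U (j - 1)))\<^sup>2))
      \<le> 2 * (F * L2_norm \<Omega> (sigma_avg \<alpha> U n))"
    and "(\<Sum>j=1..n. coeff_g \<alpha> T r N n j * ((grad_norm \<Omega> (U j))\<^sup>2 - (grad_norm \<Omega> (U (j - 1)))\<^sup>2))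
      \<le> F\<^sup>2 / (2 * m1)"
proof -
  let ?V = "fem_space \<Omega> Th" and ?f = "f (node_sigma \<alpha> T r N n)"
  let ?s = "sigma_avg \<alpha> U n" and ?D = "L2_1sigma \<alpha> T r N U n"
  let ?A = "a (total \<Omega> ?s)"
  note V = lincomb_closed_fem_space[OF \<Omega>, of Th]
  have Uj: "U j \<in> ?V" if "j \<le> n" for j
    using U that mesh unfolding fully_discrete_solution_def by (cases "j = 0") auto
  have eq: "L2_inner \<Omega> ?D v + ?A * grad_inner \<Omega> ?s v = L2_inner \<Omega> ?f v" if "v \<in> ?V" for v
    using U that mesh unfolding fully_discrete_solution_def by simp
  have sV: "?s \<in> ?V" by (intro lincomb_closed_sigma_avg V Uj) simp_all
  have DV: "?D \<in> ?V" by (intro lincomb_closed_L2_1sigma V Uj)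
  note H1 = fem_space_H1[OF \<Omega>] and L2 = sobolev_H1_L2[OF \<Omega> fem_space_H1[OF \<Omega>]]
  note g = coeff_g_pos[OF \<alpha> mesh] coeff_g_mono[OF \<alpha> mesh(1-4)] coeff_g_last[OF \<alpha> mesh(1-4)]
  have \<sigma>: "0 \<le> \<alpha> / 2" "\<alpha> / 2 < 1 / 2" using \<alpha> by auto
  have f0: "0 \<le> F" using f(2) L2_norm_nonneg[of \<Omega> ?f] by linarith
  have load: "L2_inner \<Omega> ?f v \<le> F * L2_norm \<Omega> v" if "v \<in> ?V" for v
  proof -
    have "L2_inner \<Omega> ?f v \<le> L2_norm \<Omega> ?f * L2_norm \<Omega> v"
      by (rule L2_Cauchy_Schwarz[OF f(1) L2[OF that]])
    also have "\<dots> \<le> F * L2_norm \<Omega> v" using f(2) by (intro mult_right_mono) auto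
    finally show ?thesis .
  qed
  have "(\<Sum>j=1..n. coeff_g \<alpha> T r N n j * (L2_inner \<Omega> (U j) (U j) - L2_inner \<Omega> (U (j - 1)) (U (j - 1)))) / 2
      \<le> L2_inner \<Omega> ?D ?s"
    unfolding L2_1sigma_def sigma_avg_def Let_def
    by (rule L2_inner_sigma_avg_lower[OF mesh(4) \<sigma>]) (use g L2[OF Uj] in auto)
  moreover have "0 \<le> ?A * grad_inner \<Omega> ?s ?s"
    using m1 by (intro mult_nonneg_nonneg grad_inner_self_nonneg[OF \<Omega>] order_trans[OF less_imp_le m1(2)])
  ultimately show "(\<Sum>j=1..n. coeff_g \<alpha> T r N n j * ((L2_norm \<Omega> (U j))\<^sup>2 - (L2_norm \<Omega> (U (j - 1)))\<^sup>2))
      \<le> 2 * (F * L2_norm \<Omega> ?s)"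
    using eq[OF sV] load[OF sV] by (simp add: L2_norm_squared)
  have "(\<Sum>j=1..n. coeff_g \<alpha> T r N n j * (grad_inner \<Omega> (U j) (U j) - grad_inner \<Omega> (U (j - 1)) (U (j - 1)))) / 2
      \<le> grad_inner \<Omega> ?D ?s"
    unfolding L2_1sigma_def sigma_avg_def Let_def
    by (rule grad_inner_sigma_avg_lower[OF \<Omega> mesh(4) \<sigma>]) (use g H1[OF Uj] in auto)
  \<comment> \<open>The coefficient may be replaced by \<open>m1\<close> only in front of a
    nonnegative gradient product; a negative one satisfies the bound trivially.\<close>
  moreover have "grad_inner \<Omega> ?D ?s \<le> F\<^sup>2 / (4 * m1)"
  proof (cases "0 \<le> grad_inner \<Omega> ?s ?D")
    case True
    \<comment> \<open>Young's inequality, weighted so that the squared norm of the discrete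
      derivative cancels exactly.\<close>
    have "0 \<le> (F / 2 - L2_norm \<Omega> ?D)\<^sup>2" by simp
    then have "F * L2_norm \<Omega> ?D \<le> F\<^sup>2 / 4 + L2_inner \<Omega> ?D ?D"
      by (simp add: power2_diff L2_norm_squared power_divide)
    then have "?A * grad_inner \<Omega> ?s ?D \<le> F\<^sup>2 / 4"
      using eq[OF DV] load[OF DV] by linarith
    moreover have "m1 * grad_inner \<Omega> ?s ?D \<le> ?A * grad_inner \<Omega> ?s ?D"
      using True m1 by (intro mult_right_mono)
    ultimately have "m1 * grad_inner \<Omega> ?s ?D \<le> F\<^sup>2 / 4" by linarith
    then show ?thesis
      using m1(1) by (simp add: grad_inner_commute[OF \<Omega>, of ?D] field_simps)
  next
    case False
    moreover have "0 \<le> F\<^sup>2 / (4 * m1)" using m1(1) by simp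
    ultimately show ?thesis by (simp add: grad_inner_commute[OF \<Omega>, of ?D])
  qed
  ultimately show "(\<Sum>j=1..n. coeff_g \<alpha> T r N n j * ((grad_norm \<Omega> (U j))\<^sup>2 - (grad_norm \<Omega> (U (j - 1)))\<^sup>2))
      \<le> F\<^sup>2 / (2 * m1)"
    by (simp add: grad_norm_squared[OF \<Omega>])
qed

theorem theorem3p6:
  fixes \<Omega> :: "'a::euclidean_space set"
    and a :: "real \<Rightarrow> real"
    and f :: "real \<Rightarrow> 'a \<Rightarrow> real"
    and u0 :: "'a \<Rightarrow> real"
    and \<alpha> T r m1 m2 L \<kappa> F :: real
  assumes dim: "DIM('a) = 1 \<or> DIM('a) = 2"
    and domain: "bounded_domain \<Omega>" "smooth_boundary \<Omega>"
    and params: "0 < T" "0 < \<alpha>" "\<alpha> < 1" "1 \<le> r"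
    and quasi_uniformity: "0 < \<kappa>"
    and H1: "0 < m1" "0 < m2" "\<And>x. m1 \<le> a x \<and> a x \<le> m2"
    and H2: "L-lipschitz_on UNIV a"
    and H3: "f \<in> Bochner_L2 T \<Omega>" "u0 \<in> sobolev_H10 \<Omega> \<inter> sobolev_H2 \<Omega>"
  shows "\<exists>C>0. \<forall>Th N U.
           quasi_uniform_mesh \<kappa> \<Omega> Th \<longrightarrow> N \<ge> 1 \<longrightarrow>
           (\<forall>n\<in>{1..N}. L2_norm \<Omega> (f (node_sigma \<alpha> T r N n)) \<le> F) \<longrightarrow>
           fully_discrete_solution \<Omega> a f \<alpha> T r Th N U \<longrightarrow>
           (\<forall>n\<in>{1..N}. L2_norm \<Omega> (U n) \<le> C * (1 + L2_norm \<Omega> (U 0)) \<and>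
                        grad_norm \<Omega> (U n) \<le> C * (1 + grad_norm \<Omega> (U 0)))"
proof -
  have \<Omega>: "open \<Omega>" "bounded \<Omega>" using domain by (auto simp: bounded_domain_def)
  \<comment> \<open>The lower bound for the first weight on every mesh; it depends only on
    \<open>T\<close> and \<alpha>.\<close>
  define c where "c = T powr (-\<alpha>) / Gamma (1 - \<alpha>)"
  have c: "0 < c" using params by (simp add: c_def Gamma_real_pos)
  \<comment> \<open>\<open>B\<close> and \<open>E\<close> are the increments of the L2 norm and of
    the gradient norm. The constant must be positive before a mesh is fixed, while
    \<open>F \<ge> 0\<close> is known only once some time level exists; hence the absolute
    value.\<close>
  define B where "B = 2 * \<bar>F\<bar> / c"
  define E where "E = sqrt (F\<^sup>2 / (2 * m1) / c)"
  have BE: "0 \<le> B" "0 \<le> E" using c H1 by (auto simp: B_def E_def)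
  \<comment> \<open>Both estimates arrive in the additive form \<open>x + b\<close> with
    \<open>b\<close> at most \<open>B + E\<close>, so a single constant serves both.\<close>
  have absorb: "y \<le> (1 + B + E) * (1 + x)" if "y \<le> x + b" "0 \<le> x" "b \<le> B + E" for x y b
  proof -
    have "0 \<le> (B + E) * x" using that BE by simp
    then show ?thesis using that by (simp add: algebra_simps)
  qed
  show ?thesis
  proof (intro exI[of _ "1 + B + E"] conjI allI impI ballI)
    show "0 < 1 + B + E" using BE by linarith
    fix Th N U n
    assume N: "1 \<le> N" and F: "\<forall>n\<in>{1..N}. L2_norm \<Omega> (f (node_sigma \<alpha> T r N n)) \<le> F"
      and U: "fully_discrete_solution \<Omega> a f \<alpha> T r Th N U" and n: "n \<in> {1..N}"
    have F0: "0 \<le> F" using F N L2_norm_nonneg[of \<Omega>] by (meson atLeastAtMost_iff order_trans order_refl)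
    have UL2: "U j \<in> L2_space \<Omega>" if "j \<le> N" for j
    proof -
      have "U j \<in> fem_space \<Omega> Th"
        using U that unfolding fully_discrete_solution_def by (cases "j = 0") auto
      then show ?thesis by (intro sobolev_H1_L2[OF \<Omega>] fem_space_H1[OF \<Omega>])
    qed
    have fL2: "f (node_sigma \<alpha> T r N k) \<in> L2_space \<Omega>" if "1 \<le> k" "k \<le> N" for k
      using H3(1) node_sigma_bounds[OF params(2,3,1,4) N that] by (simp add: Bochner_L2_def)
    have energy: "(\<Sum>j=1..k. coeff_g \<alpha> T r N k j * ((L2_norm \<Omega> (U j))\<^sup>2 - (L2_norm \<Omega> (U (j - 1)))\<^sup>2))
        \<le> 2 * (F * L2_norm \<Omega> (sigma_avg \<alpha> U k))"
      "(\<Sum>j=1..k. coeff_g \<alpha> T r N k j * ((grad_norm \<Omega> (U j))\<^sup>2 - (grad_norm \<Omega> (U (j - 1)))\<^sup>2))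
        \<le> F\<^sup>2 / (2 * m1)" if k: "1 \<le> k" "k \<le> N" for k
    proof -
      note est = fully_discrete_energy_estimates[OF \<Omega> params(2,3,1,4) N k H1(1) _ fL2[OF k] _ U]
      show "(\<Sum>j=1..k. coeff_g \<alpha> T r N k j * ((L2_norm \<Omega> (U j))\<^sup>2 - (L2_norm \<Omega> (U (j - 1)))\<^sup>2))
        \<le> 2 * (F * L2_norm \<Omega> (sigma_avg \<alpha> U k))"
        by (rule est(1)) (use H1(3) F k in auto)
      show "(\<Sum>j=1..k. coeff_g \<alpha> T r N k j * ((grad_norm \<Omega> (U j))\<^sup>2 - (grad_norm \<Omega> (U (j - 1)))\<^sup>2))
        \<le> F\<^sup>2 / (2 * m1)"
        by (rule est(2)) (use H1(3) F k in auto)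
    qed
    have comparison: "w k \<le> w 0 + K / c"
      if "0 \<le> K" "\<And>k. 1 \<le> k \<Longrightarrow> k \<le> N \<Longrightarrow> (\<Sum>j=1..k. coeff_g \<alpha> T r N k j * (w j - w (j - 1))) \<le> K"
        "k \<le> N" for w K k
    proof (rule discrete_comparison[OF c _ _ that])
      show "c \<le> coeff_g \<alpha> T r N k 1" if "1 \<le> k" "k \<le> N" for k
        unfolding c_def by (rule coeff_g_first_ge[OF params(2,3,1,4) N that])
      show "coeff_g \<alpha> T r N k j \<le> coeff_g \<alpha> T r N k (j + 1)" if "1 \<le> j" "j < k" "k \<le> N" for k j
        using that by (intro coeff_g_mono[OF params(2,3,1,4) N]) auto
    qed
    \<comment> \<open>The energy bound involves the norm of the \<sigma>-average, which the maximum
      over all levels controls. Comparison at a level attaining the maximum then gives a quadratic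
      inequality for \<open>M\<close>.\<close>
    define M where "M = Max ((\<lambda>k. L2_norm \<Omega> (U k)) ` {0..N})"
    have M: "L2_norm \<Omega> (U k) \<le> M" if "k \<le> N" for k
      unfolding M_def using that by (intro Max_ge) auto
    have M0: "0 \<le> M" using M[of 0] L2_norm_nonneg[of \<Omega> "U 0"] by linarith
    have "M \<in> (\<lambda>k. L2_norm \<Omega> (U k)) ` {0..N}" unfolding M_def by (intro Max_in) auto
    then obtain k where k: "k \<le> N" "M = L2_norm \<Omega> (U k)" by auto
    have "(L2_norm \<Omega> (U k))\<^sup>2 \<le> (L2_norm \<Omega> (U 0))\<^sup>2 + 2 * (F * M) / c"
    proof (rule comparison[OF _ _ k(1)])
      show "0 \<le> 2 * (F * M)" using F0 M0 by simp
      fix k assume k: "1 \<le> k" "k \<le> N"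
      have "L2_norm \<Omega> (sigma_avg \<alpha> U k) \<le> M"
        using params k by (intro sigma_avg_norm_le[OF \<Omega>] UL2 M) auto
      then have "2 * (F * L2_norm \<Omega> (sigma_avg \<alpha> U k)) \<le> 2 * (F * M)"
        using F0 by (intro mult_left_mono) auto
      then show "(\<Sum>j=1..k. coeff_g \<alpha> T r N k j * ((L2_norm \<Omega> (U j))\<^sup>2 - (L2_norm \<Omega> (U (j - 1)))\<^sup>2))
          \<le> 2 * (F * M)"
        using energy(1)[OF k] by linarith
    qed
    also have "\<dots> = (L2_norm \<Omega> (U 0))\<^sup>2 + B * M" using F0 by (simp add: B_def)
    finally have "M\<^sup>2 \<le> (L2_norm \<Omega> (U 0))\<^sup>2 + B * M" by (simp only: k(2))
    \<comment> \<open>One factor of the initial norm is raised to \<open>M\<close>, so that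
      \<open>M\<close> divides out of the quadratic inequality.\<close>
    moreover have "(L2_norm \<Omega> (U 0))\<^sup>2 \<le> L2_norm \<Omega> (U 0) * M"
      using M[of 0] by (simp add: power2_eq_square mult_left_mono)
    ultimately have "M * M \<le> (L2_norm \<Omega> (U 0) + B) * M"
      by (simp add: power2_eq_square distrib_right)
    then have "M \<le> L2_norm \<Omega> (U 0) + B"
      using M0 BE L2_norm_nonneg[of \<Omega> "U 0"] by (cases "M = 0") auto
    with M[of n] n have "L2_norm \<Omega> (U n) \<le> L2_norm \<Omega> (U 0) + B" by simp
    then show "L2_norm \<Omega> (U n) \<le> (1 + B + E) * (1 + L2_norm \<Omega> (U 0))"
      by (rule absorb) (use BE in auto)
    have g0: "0 \<le> grad_norm \<Omega> (U 0)"
      by (simp add: grad_norm_def grad_inner_self_nonneg[OF \<Omega>])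
    \<comment> \<open>Here the right-hand side of the energy bound is already constant, so
      comparison applies at level \<open>n\<close> directly.\<close>
    have "(grad_norm \<Omega> (U n))\<^sup>2 \<le> (grad_norm \<Omega> (U 0))\<^sup>2 + F\<^sup>2 / (2 * m1) / c"
      using n H1(1) by (intro comparison energy(2)) auto
    also have "\<dots> = (grad_norm \<Omega> (U 0))\<^sup>2 + E\<^sup>2" using c H1(1) by (simp add: E_def)
    also have "\<dots> \<le> (grad_norm \<Omega> (U 0) + E)\<^sup>2"
      using g0 BE by (simp add: power2_sum)
    finally have "grad_norm \<Omega> (U n) \<le> grad_norm \<Omega> (U 0) + E"
      using g0 BE by (intro power2_le_imp_le[of "grad_norm \<Omega> (U n)"]) auto
    then show "grad_norm \<Omega> (U n) \<le> (1 + B + E) * (1 + grad_norm \<Omega> (U 0))"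
      by (rule absorb) (use BE g0 in auto)
  qed
qed

end
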